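(* Let $I=[-1,1]$, let $c,\alpha>0$, let $k\ge2$ be an integer, and let $M_n=\exp^{(k)}(cn^\alpha)$ for $n\ge0$. If $\psi\in\mathcal C_M(I)$ is real-valued, then $$m_\psi(\lambda)=O\Bigl(\frac{\log\lambda}{(\log^{(k)}\lambda)^{1/\alpha}}\Bigr)\quad\text{as }\lambda\to\infty.$$ This bound is sharp: there exist a real-valued $\psi\in\mathcal C_M(I)$ and a sequence $\lambda_n\to\infty$ such that $$|m_\psi(\lambda_n)|\approx\frac{\log\lambda_n}{(\log^{(k)}\lambda_n)^{1/\alpha}}$$ for all sufficiently large $n$.
   Context: For a real-valued $\psi\in C^1(I)$, $I=[-1,1]$, and $\lambda>0$, $m_\psi(\lambda):=\mathrm{p.v.}\int_{-1}^{1}e^{i\lambda\psi(t)}\frac{dt}{t}=\lim_{\varepsilon\to0^+}\int_{\varepsilon\le|t|\le1}e^{i\lambda\psi(t)}\frac{dt}{t}$. $\exp^{(k)}$ and $\log^{(k)}$ denote the $k$-fold iterated exponential and logarithm. A function $\psi\in C^\infty(I)$ belongs to $\mathcal C_M(I)$ if there is a constant $K>0$ such that $\sup_{t\in I}|\psi^{(n)}(t)|\le K^{n+1}M_n=K^{n+1}\exp^{(k)}(cn^\alpha)$ for all $n\ge0$. Implicit constants may depend on $\psi,\alpha,c,k$ but not on $\lambda$. $X\approx Y$ means $c'Y\le X\le C'Y$ for some constants $c',C'>0$ independent of $n$ (and of $\lambda_n$). *)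

theory Defs
  imports "HOL-Analysis.Analysis" "HOL-Library.Landau_Symbols"
begin

text \<open>
  Derivatives are taken within the set \<open>S\<close>, so that on a compact interval they are
  one-sided at the end points.
\<close>

primrec nth_derivative_on :: "real set \<Rightarrow> nat \<Rightarrow> (real \<Rightarrow> real) \<Rightarrow> real \<Rightarrow> real" where
  "nth_derivative_on S 0 f = f"
| "nth_derivative_on S (Suc n) f =
     (\<lambda>t. vector_derivative (nth_derivative_on S n f) (at t within S))"

definition smooth_on :: "real set \<Rightarrow> (real \<Rightarrow> real) \<Rightarrow> bool" where
  "smooth_on S f \<longleftrightarrow> (\<forall>n. nth_derivative_on S n f differentiable_on S)"

text \<open>The supremum bound on each derivative is written as a pointwise bound.\<close>

definition carleman_class :: "real set \<Rightarrow> (nat \<Rightarrow> real) \<Rightarrow> (real \<Rightarrow> real) set" where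
  "carleman_class S M =
     {f. smooth_on S f \<and>
         (\<exists>K>0. \<forall>n. \<forall>t\<in>S. \<bar>nth_derivative_on S n f t\<bar> \<le> K ^ (n + 1) * M n)}"

text \<open>The limit exists whenever \<open>\<psi>\<close> is continuously differentiable on \<open>[-1,1]\<close>.\<close>

definition pv_oscillatory :: "(real \<Rightarrow> real) \<Rightarrow> real \<Rightarrow> complex" where
  "pv_oscillatory \<psi> x =
     Lim (at_right 0)
       (\<lambda>\<epsilon>. integral {t. \<epsilon> \<le> \<bar>t\<bar> \<and> \<bar>t\<bar> \<le> 1}
              (\<lambda>t::real. exp (\<i> * complex_of_real (x * \<psi> t)) / complex_of_real t))"

abbreviation iter_exp :: "nat \<Rightarrow> real \<Rightarrow> real" where
  "iter_exp k \<equiv> exp ^^ k"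

text \<open>This is the mathematical iterated logarithm only for sufficiently large arguments.\<close>

abbreviation iter_log :: "nat \<Rightarrow> real \<Rightarrow> real" where
  "iter_log k \<equiv> ln ^^ k"

end

theory Submission
  imports Defs
begin

text \<open>
  The upper bound is a trade-off at a single cut-off \<open>\<delta>\<close>. Fix the frequency \<open>x\<close> and let \<open>n\<close> be
  the largest integer with \<open>M\<^sub>n \<le> x\<close>, so that \<open>n\<close> is about \<open>(iter_log k x / c) powr (1 / \<alpha>)\<close>. The
  phase \<open>x \<psi>\<close> differs from \<open>x\<close> times a Taylor polynomial of degree less than \<open>n\<close> by at most
  \<open>x\<^sup>2 K\<^bsup>n + 1\<^esup> \<bar>t\<bar>\<^sup>n\<close>, which is at most \<open>1\<close> for \<open>\<bar>t\<bar> \<le> \<delta> = (x\<^sup>2 K\<^bsup>n + 1\<^esup>)\<^bsup>-1/n\<^esup>\<close>. Outside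
  \<open>[-\<delta>, \<delta>]\<close> the kernel \<open>1 / t\<close> contributes at most \<open>2 ln (1 / \<delta>)\<close>, that is \<open>O(ln x / n)\<close>. Inside, the
  integral of a polynomial phase is bounded by a power of \<open>n\<close>, uniformly in the coefficients
  (\<open>symmetric_polynomial_integral_bound\<close>), and this is negligible because \<open>ln x\<close> grows at least like
  \<open>exp (c n\<^sup>\<alpha>)\<close> when \<open>k \<ge> 2\<close>.

  The polynomial estimate compares monomials. On a logarithmic scale in \<open>t\<close> the functions
  \<open>ln (\<bar>a\<^sub>i\<bar> t\<^sup>i)\<close> are lines with distinct integer slopes, so two of them are close only on a short
  interval. Away from these intervals one monomial dominates: the phase then either is small,
  or behaves like a pure power and is handled by integration by parts. Only the number of
  transitions, quadratic in the degree, enters the bound.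

  For the sharpness the phase \<open>\<psi>\<close> is supported on the positive axis. Then the real part of the
  principal value is \<open>- \<integral> (1 - cos (x \<psi> t)) dt / t\<close>, so that the contributions of different scales
  add up without cancellation, and it suffices to make \<open>x \<psi>\<close> oscillate on many dyadic intervals
  (\<open>lacunary_flat_pv_lower_bound\<close>). The phase is a sum of rescaled copies of \<open>exp (- 1 / t)\<close> with
  weights \<open>2\<^bsup>-j N(j)\<^esup>\<close>, where \<open>N(j) - 2\<close> is the least \<open>n\<close> with \<open>j < J n\<close>. The
  \<open>n\<close>-th derivative is then of size \<open>2\<^bsup>n J n\<^esup>\<close> up to factors of the order of a factorial, and
  \<open>J n = sqrt (ln M\<^sub>n)\<close>, rounded down, keeps it below \<open>M\<^sub>n\<close>. The frequency
  \<open>L\<^sub>n\<close> of size \<open>2\<^bsup>J n (n + 2)\<^esup>\<close> makes \<open>J n\<close> scales oscillate, and \<open>J n\<close> is comparable to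
  \<open>ln L\<^sub>n / n\<close>. The upper half of the two-sided estimate along \<open>L\<^sub>n\<close> is the general upper bound.
\<close>

section \<open>Oscillatory integrals with a dominant monomial\<close>

lemma norm_integral_le_antiderivative:
  fixes f :: "real \<Rightarrow> complex" and g G :: "real \<Rightarrow> real"
  assumes "s \<le> u" "f integrable_on {s..u}"
    and "\<And>t. t \<in> {s..u} \<Longrightarrow> norm (f t) \<le> g t"
    and "\<And>t. t \<in> {s..u} \<Longrightarrow> (G has_real_derivative g t) (at t)"
  shows "norm (integral {s..u} f) \<le> G u - G s"
proof -
  have "(g has_integral (G u - G s)) {s..u}"
    using assms(1,4)
    by (intro fundamental_theorem_of_calculus)
       (auto simp: has_real_derivative_iff_has_vector_derivative has_vector_derivative_at_within)
  then show ?thesis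
    using integral_norm_bound_integral[of f "{s..u}" g] assms(2,3)
    by (metis has_integral_integrable_integral)
qed

lemma no_zero_imp_sign_constant:
  fixes q :: "real \<Rightarrow> real"
  assumes cont: "continuous_on {a..b} q" and nz: "\<And>t. a < t \<Longrightarrow> t < b \<Longrightarrow> q t \<noteq> 0"
  shows "(\<forall>t\<in>{a..b}. 0 \<le> q t) \<or> (\<forall>t\<in>{a..b}. q t \<le> 0)"
proof (rule ccontr)
  assume "\<not> ?thesis"
  then obtain s u where su: "s \<in> {a..b}" "u \<in> {a..b}" "q s < 0" "0 < q u"
    by force
  show False
  proof (cases "s \<le> u")
    case True
    then obtain x where "s \<le> x" "x \<le> u" "q x = 0"
      using IVT'[of q s 0 u] su continuous_on_subset[OF cont, of "{s..u}"] by auto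
    moreover from this su have "x \<noteq> s" "x \<noteq> u" by auto
    ultimately show False using nz[of x] su by auto
  next
    case False
    then obtain x where "u \<le> x" "x \<le> s" "q x = 0"
      using IVT2'[of q s 0 u] su continuous_on_subset[OF cont, of "{u..s}"] by auto
    moreover from this su have "x \<noteq> s" "x \<noteq> u" by auto
    ultimately show False using nz[of x] su by auto
  qed
qed

text \<open>
  Cutting at the points of \<open>B\<close> leaves at most \<open>card B + 1\<close> pieces. Counting pieces is what
  makes the bounds below depend on the degree of a polynomial and not on its coefficients.
\<close>

lemma norm_integral_le_breakpoints:
  fixes f :: "real \<Rightarrow> complex"
  assumes "finite B" "a \<le> b" "continuous_on {a..b} f" 
    and piece: "\<And>s u. \<lbrakk>a \<le> s; s \<le> u; u \<le> b; B \<inter> {s<..<u} = {}\<rbrakk> \<Longrightarrow> norm (integral {s..u} f) \<le> C"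
  shows "norm (integral {a..b} f) \<le> (real (card B) + 1) * C"
proof -
  have C: "0 \<le> C" using piece[of a a] \<open>a \<le> b\<close> by simp
  have "norm (integral {s..b} f) \<le> (real n + 1) * C"
    if "a \<le> s" "s \<le> b" "card (B \<inter> {s<..<b}) = n" for n s
    using that
  proof (induction n arbitrary: s)
    case 0
    then have "B \<inter> {s<..<b} = {}" using \<open>finite B\<close> by simp
    then show ?case using piece[of s b] 0 by simp
  next
    case (Suc n)
    define x where "x = Min (B \<inter> {s<..<b})"
    have ne: "B \<inter> {s<..<b} \<noteq> {}" using Suc.prems by auto
    then have x: "x \<in> B \<inter> {s<..<b}" "\<And>y. y \<in> B \<inter> {s<..<b} \<Longrightarrow> x \<le> y"
      unfolding x_def using \<open>finite B\<close> by (auto intro!: Min_in simp del: Int_iff)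
    have "B \<inter> {x<..<b} = (B \<inter> {s<..<b}) - {x}" using x by force
    then have "card (B \<inter> {x<..<b}) = n" using Suc.prems x by simp
    then have 1: "norm (integral {x..b} f) \<le> (real n + 1) * C" using Suc x by auto
    have "B \<inter> {s<..<x} = {}" using x by force
    then have 2: "norm (integral {s..x} f) \<le> C" using Suc.prems x piece[of s x] by auto
    have "f integrable_on {s..b}"
      using assms(3) Suc.prems by (intro integrable_continuous_interval) (auto intro: continuous_on_subset)
    then have "integral {s..b} f = integral {s..x} f + integral {x..b} f"
      using x by (intro Henstock_Kurzweil_Integration.integral_combine[symmetric]) auto
    then have "norm (integral {s..b} f) \<le> C + (real n + 1) * C"
      using norm_triangle_mono[OF 2 1] by simp
    then show ?case by (simp add: algebra_simps)
  qed
  from this[of a] have "norm (integral {a..b} f) \<le> (real (card (B \<inter> {a<..<b})) + 1) * C"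
    using \<open>a \<le> b\<close> by simp
  also have "\<dots> \<le> (real (card B) + 1) * C"
    using C \<open>finite B\<close> by (intro mult_right_mono) (auto intro: card_mono)
  finally show ?thesis .
qed

text \<open>
  This is integration by parts for the measure \<open>dt / t\<close>: with \<open>D t = t * \<phi>' t\<close>, the function
  \<open>exp (i \<phi>) / (i D)\<close> is an antiderivative of \<open>exp (i \<phi>) / t\<close> up to an error of size
  \<open>\<bar>D'\<bar> / D\<^sup>2\<close>. The hypothesis on this error has the form met when a monomial that is at least
  \<open>1\<close> at \<open>s\<close> dominates the phase; its integral is at most \<open>8\<close>, whatever \<open>s\<close> and \<open>u\<close> are.
\<close>

lemma norm_oscillatory_integral_le:
  fixes \<phi> D D' :: "real \<Rightarrow> real"
  assumes s: "0 < s" "s \<le> u"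
    and \<phi>: "\<And>t. t \<in> {s..u} \<Longrightarrow> (\<phi> has_real_derivative D t / t) (at t)"
    and D: "\<And>t. t \<in> {s..u} \<Longrightarrow> (D has_real_derivative D' t) (at t)"
    and lower: "\<And>t. t \<in> {s..u} \<Longrightarrow> 1 \<le> 2 * \<bar>D t\<bar>"
    and upper: "\<And>t. t \<in> {s..u} \<Longrightarrow> \<bar>D' t\<bar> / (D t)\<^sup>2 \<le> 8 * s / t\<^sup>2"
  shows "norm (integral {s..u} (\<lambda>t. exp (\<i> * complex_of_real (\<phi> t)) / complex_of_real t)) \<le> 12"
proof -
  define e where "e = (\<lambda>t. exp (\<i> * complex_of_real (\<phi> t)))"
  define r where "r = (\<lambda>t. e t * D' t / (\<i> * (D t)\<^sup>2))"
  have ne[simp]: "norm (e t) = 1" for t by (simp add: e_def norm_exp_i_times)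
  have D0: "D t \<noteq> 0" if "t \<in> {s..u}" for t using lower[OF that] by auto
  have e': "(e has_vector_derivative \<i> * (D t / t) * e t) (at t)" if "t \<in> {s..u}" for t
  proof -
    have "((\<lambda>t. \<i> * complex_of_real (\<phi> t)) has_vector_derivative \<i> * complex_of_real (D t / t)) (at t)"
      using \<phi>[OF that] by (auto intro!: derivative_eq_intros
          simp: has_real_derivative_iff_has_vector_derivative)
    from field_vector_diff_chain_at[OF this DERIV_exp] show ?thesis
      unfolding e_def by (simp add: o_def)
  qed
  \<comment> \<open>By the chain rule \<open>e' = i (D / t) e\<close>; so \<open>e / (i D)\<close> has derivative \<open>e / t\<close>, up to the
    term \<open>r\<close> from differentiating \<open>1 / D\<close>.\<close>
  have FTC: "((\<lambda>t. e t / t - r t) has_integral (e u / (\<i> * D u) - e s / (\<i> * D s))) {s..u}"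
  proof (rule fundamental_theorem_of_calculus[OF s(2)])
    fix t assume t: "t \<in> {s..u}"
    have Dv: "((\<lambda>t. \<i> * complex_of_real (D t)) has_vector_derivative \<i> * complex_of_real (D' t)) (at t)"
      using D[OF t] by (auto intro!: derivative_eq_intros
          simp: has_real_derivative_iff_has_vector_derivative)
    have ne0: "\<i> * complex_of_real (D t) \<noteq> 0" using D0[OF t] by simp
    have inv: "((\<lambda>t. inverse (\<i> * complex_of_real (D t))) has_vector_derivative
        \<i> * complex_of_real (D' t) * (- (inverse (\<i> * complex_of_real (D t)) ^ Suc (Suc 0)))) (at t)"
      using field_vector_diff_chain_at[OF Dv DERIV_inverse[OF ne0]] by (simp add: o_def)
    have "((\<lambda>t. e t * inverse (\<i> * complex_of_real (D t))) has_vector_derivative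
       (e t * (\<i> * complex_of_real (D' t) * (- (inverse (\<i> * complex_of_real (D t)) ^ Suc (Suc 0)))) +
       \<i> * (D t / t) * e t * inverse (\<i> * complex_of_real (D t)))) (at t)"
      by (rule has_vector_derivative_mult[OF e'[OF t] inv])
    moreover have "(e t * (\<i> * complex_of_real (D' t) * (- (inverse (\<i> * complex_of_real (D t)) ^ Suc (Suc 0)))) +
       \<i> * (D t / t) * e t * inverse (\<i> * complex_of_real (D t))) = e t / t - r t"
      using D0[OF t] t s by (simp add: r_def field_simps power2_eq_square)
    ultimately show "((\<lambda>t. e t / (\<i> * complex_of_real (D t))) has_vector_derivative (e t / t - r t)) (at t within {s..u})"
      by (simp add: divide_inverse has_vector_derivative_at_within)
  qed
  have conte: "continuous_on {s..u} e"
    by (meson e' continuous_at_imp_continuous_on has_vector_derivative_continuous)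
  have int: "(\<lambda>t. e t / t) integrable_on {s..u}"
    using s conte by (intro integrable_continuous_interval continuous_intros) auto
  have "((\<lambda>t. e t / t - (e t / t - r t)) has_integral (integral {s..u} (\<lambda>t. e t / t) - (e u / (\<i> * D u) - e s / (\<i> * D s)))) {s..u}"
    using has_integral_diff[OF integrable_integral[OF int] FTC] .
  then have r: "(r has_integral (integral {s..u} (\<lambda>t. e t / t) - (e u / (\<i> * D u) - e s / (\<i> * D s)))) {s..u}"
    by simp
  have "norm (integral {s..u} r) \<le> - (8 * s / u) - - (8 * s / s)"
  proof (rule norm_integral_le_antiderivative[OF s(2), where g = "\<lambda>t. 8 * s / t\<^sup>2"])
    show "r integrable_on {s..u}" using r by blast
    fix t assume t: "t \<in> {s..u}"
    show "norm (r t) \<le> 8 * s / t\<^sup>2"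
      using upper[OF t] by (simp add: r_def norm_mult norm_divide norm_power)
    show "((\<lambda>t. - (8 * s / t)) has_real_derivative 8 * s / t\<^sup>2) (at t)"
      using s t by (auto intro!: derivative_eq_intros simp: power2_eq_square)
  qed
  also have "\<dots> \<le> 8" using s by simp
  finally have "norm (integral {s..u} r) \<le> 8" .
  moreover have bd: "norm (e t / (\<i> * D t)) \<le> 2" if "t \<in> {s..u}" for t
    using lower[OF that] D0[OF that] by (simp add: norm_divide norm_mult divide_simps)
  moreover have "integral {s..u} (\<lambda>t. e t / t) = integral {s..u} r + (e u / (\<i> * D u) - e s / (\<i> * D s))"
    using r by (simp add: integral_unique)
  moreover have "norm (integral {s..u} r + (e u / (\<i> * D u) - e s / (\<i> * D s))) \<le> 8 + (2 + 2)"
    using calculation(1) bd[of u] bd[of s] s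
    by (intro norm_triangle_mono norm_triangle_le_diff add_mono) auto
  ultimately show ?thesis by (simp add: e_def)
qed

lemma monomial_mono_ratio:
  fixes s t w :: real
  assumes "0 < s" "s \<le> t" "1 \<le> j" "0 \<le> w" "1 \<le> w * s ^ j"
  shows "t \<le> s * (w * t ^ j)"
proof -
  have "t / s \<le> (t / s) ^ j"
    using assms by (intro self_le_power) auto
  also have "\<dots> \<le> (t / s) ^ j * (w * s ^ j)"
    using assms mult_left_mono[of 1 "w * s ^ j" "(t / s) ^ j"] by simp
  also have "\<dots> = w * t ^ j"
    using assms by (simp add: power_divide)
  finally show ?thesis using assms by (simp add: field_simps)
qed

text \<open>
  When one monomial exceeds all others by the factor \<open>R = 2 m\<^sup>3\<close>, the sums \<open>\<Sum> i a\<^sub>i t\<^sup>i\<close> and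
  \<open>\<Sum> i\<^sup>2 a\<^sub>i t\<^sup>i\<close> are both controlled by their \<open>j\<close>-th term: the remaining terms number less than
  \<open>m\<close> and carry factors of at most \<open>m\<^sup>2\<close>. So the phase behaves like a pure power, and the
  integration by parts loses only an absolute constant.
\<close>

lemma oscillatory_integral_dominant_monomial:
  fixes a :: "nat \<Rightarrow> real"
  assumes su: "0 < s" "s \<le> u" and j: "j \<in> {1..m}"
    and R: "R = 2 * real m ^ 3"
    and dom: "\<And>i t. \<lbrakk>i \<in> {1..m}; i \<noteq> j; t \<in> {s..u}\<rbrakk> \<Longrightarrow> R * (\<bar>a i\<bar> * t ^ i) \<le> \<bar>a j\<bar> * t ^ j"
    and big: "1 \<le> \<bar>a j\<bar> * s ^ j"
  shows "norm (integral {s..u} (\<lambda>t. exp (\<i> * complex_of_real (\<Sum>i\<le>m. a i * t ^ i)) / complex_of_real t)) \<le> 12"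
proof -
  \<comment> \<open>\<open>D\<close> is \<open>t\<close> times the derivative of the phase, and \<open>D'\<close> is its derivative.\<close>
  define D where "D = (\<lambda>t. \<Sum>i=1..m. real i * a i * t ^ i)"
  define D' where "D' = (\<lambda>t. \<Sum>i=1..m. real i ^ 2 * a i * t ^ (i - 1))"
  have m1: "1 \<le> m" using j by simp
  then have m1': "1 \<le> real m" by simp
  have Rpos: "0 < R" using m1 R by simp
  have main: "real j * (\<bar>a j\<bar> * t ^ j) \<le> 2 * \<bar>D t\<bar> \<and> t * \<bar>D' t\<bar> \<le> 2 * real j ^ 2 * (\<bar>a j\<bar> * t ^ j)
      \<and> t \<le> s * (\<bar>a j\<bar> * t ^ j)" if t: "t \<in> {s..u}" for t
  proof -
    define w where "w = \<bar>a j\<bar> * t ^ j"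
    have t0: "0 < t" using t su by simp
    have ws: "t \<le> s * w" unfolding w_def
      using monomial_mono_ratio[of s t j "\<bar>a j\<bar>"] su t j big by simp
    then have w0: "0 < w" using t0 su by (smt (verit) mult_nonneg_nonpos)
    have small: "\<bar>a i\<bar> * t ^ i \<le> w / R" if "i \<in> {1..m} - {j}" for i
      using dom[of i t] that t Rpos by (simp add: w_def pos_le_divide_eq mult.commute)
    have rest: "(\<Sum>i\<in>{1..m} - {j}. real i ^ p * (\<bar>a i\<bar> * t ^ i)) \<le> real m * (real m ^ p * (w / R))" for p
    proof -
      have "(\<Sum>i\<in>{1..m} - {j}. real i ^ p * (\<bar>a i\<bar> * t ^ i)) \<le> (\<Sum>i\<in>{1..m} - {j}. real m ^ p * (w / R))"
        using small t0 by (intro sum_mono mult_mono power_mono) auto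
      also have "\<dots> \<le> real m * (real m ^ p * (w / R))"
        using w0 Rpos j m1 by (simp add: divide_right_mono mult_right_mono)
      finally show ?thesis .
    qed
    have Rm2: "real m * (real m ^ 1 * (w / R)) \<le> w / 2"
    proof -
      have "real m * (real m ^ 1 * (w / R)) = w / (2 * real m)"
        using m1 by (simp add: R power3_eq_cube)
      also have "\<dots> \<le> w / 2" using w0 m1 by (intro divide_left_mono) auto
      finally show ?thesis .
    qed
    have Rm3: "real m * (real m ^ 2 * (w / R)) = w / 2"
      using m1 by (simp add: R power3_eq_cube power2_eq_square)
    have Dsplit: "D t = real j * a j * t ^ j + (\<Sum>i\<in>{1..m} - {j}. real i * a i * t ^ i)"
      unfolding D_def using j by (subst sum.remove[of _ j]) auto
    have "\<bar>\<Sum>i\<in>{1..m} - {j}. real i * a i * t ^ i\<bar> \<le> (\<Sum>i\<in>{1..m} - {j}. real i ^ 1 * (\<bar>a i\<bar> * t ^ i))"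
      using t0 by (intro order.trans[OF sum_abs] sum_mono) (auto simp: abs_mult)
    also have "\<dots> \<le> w / 2" using rest[of 1] Rm2 by linarith
    finally have r1: "\<bar>\<Sum>i\<in>{1..m} - {j}. real i * a i * t ^ i\<bar> \<le> w / 2" .
    have top: "\<bar>real j * a j * t ^ j\<bar> = real j * w" using t0 by (simp add: w_def abs_mult)
    have jw: "w \<le> real j * w" using j w0 by (simp add: mult_le_cancel_right1)
    have 1: "real j * w \<le> 2 * \<bar>D t\<bar>"
      using Dsplit r1 top jw by linarith
    have "t * D' t = (\<Sum>i=1..m. real i ^ 2 * a i * t ^ i)"
      unfolding D'_def sum_distrib_left
    proof (intro sum.cong refl)
      fix i assume "i \<in> {1..m}"
      then obtain i' where "i = Suc i'" by (cases i) auto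
      then show "t * ((real i)\<^sup>2 * a i * t ^ (i - 1)) = (real i)\<^sup>2 * a i * t ^ i" by simp
    qed
    also have "\<dots> = real j ^ 2 * a j * t ^ j + (\<Sum>i\<in>{1..m} - {j}. real i ^ 2 * a i * t ^ i)"
      using j by (subst sum.remove[of _ j]) auto
    finally have tD': "t * D' t = real j ^ 2 * a j * t ^ j + (\<Sum>i\<in>{1..m} - {j}. real i ^ 2 * a i * t ^ i)" .
    have "\<bar>\<Sum>i\<in>{1..m} - {j}. real i ^ 2 * a i * t ^ i\<bar> \<le> (\<Sum>i\<in>{1..m} - {j}. real i ^ 2 * (\<bar>a i\<bar> * t ^ i))"
      using t0 by (intro order.trans[OF sum_abs] sum_mono) (auto simp: abs_mult)
    also have "\<dots> \<le> w / 2" using rest[of 2] Rm3 by linarith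
    finally have r2: "\<bar>\<Sum>i\<in>{1..m} - {j}. real i ^ 2 * a i * t ^ i\<bar> \<le> w / 2" .
    have top2: "\<bar>real j ^ 2 * a j * t ^ j\<bar> = real j ^ 2 * w" using t0 by (simp add: w_def abs_mult)
    have jw2: "w \<le> real j ^ 2 * w" using j w0 by (simp add: mult_le_cancel_right1)
    have "t * \<bar>D' t\<bar> = \<bar>t * D' t\<bar>" using t0 by (simp add: abs_mult)
    also have "\<dots> \<le> 2 * real j ^ 2 * w" using tD' r2 top2 jw2 w0 by linarith
    finally show ?thesis using 1 ws by (simp add: w_def)
  qed
  show ?thesis
  proof (rule norm_oscillatory_integral_le[OF su])
    fix t assume t: "t \<in> {s..u}"
    then have t0: "0 < t" using su by simp
    define w where "w = \<bar>a j\<bar> * t ^ j"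
    have main': "real j * w \<le> 2 * \<bar>D t\<bar>" "t * \<bar>D' t\<bar> \<le> 2 * real j ^ 2 * w" "t \<le> s * w"
      using main[OF t] by (auto simp: w_def)
    have w0: "0 < w" using t0 su main'(3) by (smt (verit) mult_nonneg_nonpos)
    have "1 \<le> w" 
      using big t su power_mono[of s t j] unfolding w_def by (smt (verit) abs_ge_zero atLeastAtMost_iff mult_left_mono)
    moreover have jw: "w \<le> real j * w" using j w0 by (simp add: mult_le_cancel_right1)
    ultimately show "1 \<le> 2 * \<bar>D t\<bar>" using main' by linarith
    show "\<bar>D' t\<bar> / (D t)\<^sup>2 \<le> 8 * s / t\<^sup>2"
    proof -
      have jw0: "0 < real j * w" using jw w0 by linarith
      have "(real j * w)\<^sup>2 \<le> (2 * \<bar>D t\<bar>)\<^sup>2" using main'(1) jw0 by (intro power_mono) auto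
      then have D2: "(real j * w)\<^sup>2 / 4 \<le> (D t)\<^sup>2" by (simp add: power_mult_distrib)
      have "\<bar>D' t\<bar> / (D t)\<^sup>2 \<le> (2 * real j ^ 2 * w / t) / ((real j * w)\<^sup>2 / 4)"
        using main'(2) t0 jw0 D2 w0 j by (intro frac_le) (auto simp: pos_le_divide_eq mult.commute)
      also have "\<dots> = 8 / (t * w)" using w0 j t0 by (simp add: power_mult_distrib field_simps power2_eq_square)
      also have "\<dots> \<le> 8 * s / t\<^sup>2"
        using main'(3) w0 t0 su by (simp add: field_simps power2_eq_square)
      finally show ?thesis .
    qed
    have eq: "(\<Sum>i\<le>m. a i * (real i * t ^ (i - Suc 0))) = D t / t"
    proof -
      have "(\<Sum>i\<le>m. a i * (real i * t ^ (i - Suc 0))) = (\<Sum>i=1..m. a i * (real i * t ^ (i - Suc 0)))"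
        by (rule sum.mono_neutral_right) (auto simp: Suc_le_eq)
      also have "\<dots> = (\<Sum>i=1..m. real i * a i * t ^ i / t)"
      proof (intro sum.cong refl)
        fix i assume "i \<in> {1..m}"
        then obtain i' where "i = Suc i'" by (cases i) auto
        then show "a i * (real i * t ^ (i - Suc 0)) = real i * a i * t ^ i / t" using t0 by simp
      qed
      finally show ?thesis by (simp add: D_def sum_divide_distrib)
    qed
    have "((\<lambda>t. \<Sum>i\<le>m. a i * t ^ i) has_real_derivative (\<Sum>i\<le>m. a i * (real i * t ^ (i - Suc 0)))) (at t)"
      by (auto intro!: derivative_eq_intros sum.cong simp: mult_ac)
    then show "((\<lambda>t. \<Sum>i\<le>m. a i * t ^ i) has_real_derivative D t / t) (at t)"
      using eq by simp
    show "(D has_real_derivative D' t) (at t)"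
      unfolding D_def D'_def
      by (auto intro!: derivative_eq_intros sum.cong simp: power2_eq_square mult_ac)
  qed
qed

section \<open>Symmetric oscillatory integrals of polynomials\<close>

text \<open>
  The quotient of two different monomials changes at least as fast as \<open>t\<close> or \<open>1 / t\<close>, hence it
  stays within \<open>[1 / R, R]\<close> only on an interval of bounded logarithmic length.
\<close>

lemma comparable_monomials_imp_short:
  fixes s u A B R :: real
  assumes "0 < s" "s \<le> u" "1 \<le> R" "0 < A" "0 < B" "i \<noteq> j"
    and "A * s ^ i \<le> R * (B * s ^ j)" "B * s ^ j \<le> R * (A * s ^ i)"
    and "A * u ^ i \<le> R * (B * u ^ j)" "B * u ^ j \<le> R * (A * u ^ i)"
  shows "u \<le> R\<^sup>2 * s"
proof -
  have *: "u \<le> R\<^sup>2 * s"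
    if "j < i" "0 < A" "0 < B" "B * s ^ j \<le> R * (A * s ^ i)" "A * u ^ i \<le> R * (B * u ^ j)"
    for i j A B
  proof -
    define q where "q = u / s"
    have q: "1 \<le> q" "u = q * s" using assms by (auto simp: q_def)
    have "(A * s ^ i) * q ^ i \<le> R * ((B * s ^ j) * q ^ j)"
      using that(5) by (simp add: q(2) power_mult_distrib mult_ac)
    also have "\<dots> \<le> R * ((R * (A * s ^ i)) * q ^ j)"
      using that(4) assms(3) q by (intro mult_left_mono mult_right_mono) auto
    finally have "(A * s ^ i) * q ^ i \<le> (A * s ^ i) * (R\<^sup>2 * q ^ j)"
      by (simp add: power2_eq_square mult_ac)
    then have "q ^ i \<le> R\<^sup>2 * q ^ j" using that assms by simp
    moreover have "q ^ i = q ^ (i - j) * q ^ j" using that by (simp flip: power_add)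
    ultimately have "q ^ (i - j) \<le> R\<^sup>2" using q by simp
    moreover have "q \<le> q ^ (i - j)" using q that by (intro self_le_power) auto
    ultimately show ?thesis using q assms by simp
  qed
  show ?thesis
  proof (cases "j < i")
    case True
    with assms show ?thesis by (intro *[of j i A B])
  next
    case False
    with assms show ?thesis by (intro *[of i j B A]) auto
  qed
qed

lemma continuous_on_exp_quotient:
  fixes p :: "real \<Rightarrow> real"
  assumes "continuous_on S p" "0 \<notin> S"
  shows "continuous_on S (\<lambda>t. exp (\<i> * complex_of_real (p t)) / complex_of_real t)"
  using assms by (intro continuous_intros) auto

lemma norm_exp_i_diff_le: "norm (exp (\<i> * complex_of_real x) - exp (\<i> * complex_of_real y)) \<le> \<bar>x - y\<bar>"
proof -
  have "exp (\<i> * complex_of_real x) - exp (\<i> * complex_of_real y)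
     = exp (\<i> * complex_of_real y) * (exp (\<i> * complex_of_real (x - y)) - 1)"
    by (simp add: algebra_simps flip: exp_add)
  then have "norm (exp (\<i> * complex_of_real x) - exp (\<i> * complex_of_real y))
     = norm (exp (\<i> * complex_of_real (x - y)) - 1)"
    by (simp add: norm_mult)
  also have "\<dots> \<le> \<bar>x - y\<bar>"
    using abs_sin_x_le_abs_x[of "(x - y) / 2"] by (simp only: dist_exp_i_1) simp
  finally show ?thesis .
qed

lemma norm_exp_i_diff_le_2: "norm (exp (\<i> * complex_of_real x) - exp (\<i> * complex_of_real y)) \<le> 2"
  using norm_triangle_ineq4[of "exp (\<i> * complex_of_real x)" "exp (\<i> * complex_of_real y)"] by simp

lemma sum_alternating_coeffs:
  fixes a :: "nat \<Rightarrow> real"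
  shows "(\<Sum>i\<le>m. a i * (- t) ^ i) = (\<Sum>i\<le>m. (a i * (- 1) ^ i) * t ^ i)"
  by (intro sum.cong refl) (simp add: power_minus[of t] mult_ac)

text \<open>
  There are three kinds of intervals on which all size comparisons between monomials are
  settled. If one monomial dominates and is at least \<open>1\<close>, the integrals of \<open>exp (i P(t)) / t\<close> and
  \<open>exp (i P(-t)) / t\<close> are bounded separately by integration by parts. If one dominates and is at
  most \<open>1\<close>, the difference \<open>\<bar>P t - P (- t)\<bar> / t\<close> is integrable with a uniform bound. If none
  dominates, two monomials are comparable and the interval is logarithmically short.
\<close>

lemma symmetric_integral_piece:
  fixes a :: "nat \<Rightarrow> real" and m :: nat
  defines "P \<equiv> (\<lambda>t. \<Sum>i\<le>m. a i * t ^ i)"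
  assumes su: "0 < s" "s \<le> u" and m: "1 \<le> m" and R: "R = 2 * real m ^ 3"
    and pair: "\<And>i j. \<lbrakk>i \<in> {1..m}; j \<in> {1..m}; i \<noteq> j\<rbrakk> \<Longrightarrow>
        (\<forall>t\<in>{s..u}. R * (\<bar>a i\<bar> * t ^ i) \<le> \<bar>a j\<bar> * t ^ j) \<or> (\<forall>t\<in>{s..u}. \<bar>a j\<bar> * t ^ j \<le> R * (\<bar>a i\<bar> * t ^ i))"
    and unit: "\<And>j. j \<in> {1..m} \<Longrightarrow> (\<forall>t\<in>{s..u}. 1 \<le> \<bar>a j\<bar> * t ^ j) \<or> (\<forall>t\<in>{s..u}. \<bar>a j\<bar> * t ^ j \<le> 1)"
  shows "norm (integral {s..u} (\<lambda>t. (exp (\<i> * complex_of_real (P t)) - exp (\<i> * complex_of_real (P (- t)))) / complex_of_real t))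
     \<le> 32 * real m ^ 3"
proof -
  define G where "G = (\<lambda>t. (exp (\<i> * complex_of_real (P t)) - exp (\<i> * complex_of_real (P (- t)))) / complex_of_real t)"
  have m3: "1 \<le> real m ^ 3" using m by simp
  have R2: "2 \<le> R" using m3 R by simp
  have contP: "continuous_on S P" "continuous_on S (\<lambda>t. P (- t))" for S
    unfolding P_def by (intro continuous_intros)+
  have contG: "continuous_on {s..u} G"
    unfolding G_def using su by (intro continuous_intros contP) auto
  then have intG: "G integrable_on {s..u}" by (rule integrable_continuous_interval)
  define w where "w = (\<lambda>j t. \<bar>a j\<bar> * t ^ j)"
  obtain j where j: "j \<in> {1..m}" "\<And>i. i \<in> {1..m} \<Longrightarrow> w i s \<le> w j s"
  proof -
    have "Max ((\<lambda>i. w i s) ` {1..m}) \<in> (\<lambda>i. w i s) ` {1..m}" using m by (intro Max_in) auto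
    then obtain j where "j \<in> {1..m}" "w j s = Max ((\<lambda>i. w i s) ` {1..m})" by auto
    then show ?thesis by (intro that[of j]) auto
  qed
  have Gnorm: "norm (G t) \<le> 2 * (\<Sum>i=1..m. w i t) / t" if "0 < t" for t
  proof -
    have "P t - P (- t) = (\<Sum>i\<le>m. a i * t ^ i - a i * (- t) ^ i)" by (simp add: P_def sum_subtractf)
    also have "\<dots> = (\<Sum>i=1..m. a i * t ^ i - a i * (- t) ^ i)"
      by (rule sum.mono_neutral_right) (auto simp: Suc_le_eq)
    also have "\<bar>\<dots>\<bar> \<le> (\<Sum>i=1..m. 2 * w i t)"
    proof (intro order.trans[OF sum_abs] sum_mono)
      fix i
      have "\<bar>a i * t ^ i - a i * (- t) ^ i\<bar> \<le> \<bar>a i * t ^ i\<bar> + \<bar>a i * (- t) ^ i\<bar>" by (rule abs_triangle_ineq4)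
      also have "\<dots> = 2 * w i t" using that by (simp add: w_def abs_mult power_abs)
      finally show "\<bar>a i * t ^ i - a i * (- t) ^ i\<bar> \<le> 2 * w i t" .
    qed
    finally have "\<bar>P t - P (- t)\<bar> \<le> 2 * (\<Sum>i=1..m. w i t)" by (simp add: sum_distrib_left)
    then have "norm (exp (\<i> * complex_of_real (P t)) - exp (\<i> * complex_of_real (P (- t)))) \<le> 2 * (\<Sum>i=1..m. w i t)"
      using norm_exp_i_diff_le order.trans by blast
    then show ?thesis using that by (simp add: G_def norm_divide divide_right_mono)
  qed
  have "norm (integral {s..u} G) \<le> 32 * real m ^ 3"
  proof (cases "a j = 0")
    case True
    have "\<bar>a i\<bar> = 0" if "i \<in> {1..m}" for i
      using j(2)[OF that] True zero_less_power[OF su(1), of i] by (simp add: w_def mult_le_0_iff)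
    then have "w i t = 0" if "i \<in> {1..m}" for i t using that by (simp add: w_def)
    then have "norm (G t) \<le> 0" if "t \<in> {s..u}" for t
      using Gnorm[of t] that su by simp
    then have "integral {s..u} G = integral {s..u} (\<lambda>_. 0)" by (intro integral_cong) simp
    then show ?thesis using m3 by simp
  next
    case aj: False
    show ?thesis
    proof (cases "\<exists>j\<in>{1..m}. a j \<noteq> 0 \<and> (\<forall>i\<in>{1..m}. i \<noteq> j \<longrightarrow> (\<forall>t\<in>{s..u}. R * w i t \<le> w j t))")
      case True
      then obtain j where j: "j \<in> {1..m}" "a j \<noteq> 0"
        and dom: "\<And>i t. \<lbrakk>i \<in> {1..m}; i \<noteq> j; t \<in> {s..u}\<rbrakk> \<Longrightarrow> R * w i t \<le> w j t" by auto
      show ?thesis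
      proof (cases "1 \<le> w j s")
        case True
        have eqG: "integral {s..u} G =
            integral {s..u} (\<lambda>t. exp (\<i> * complex_of_real (P t)) / complex_of_real t) -
            integral {s..u} (\<lambda>t. exp (\<i> * complex_of_real (P (- t))) / complex_of_real t)"
          unfolding G_def diff_divide_distrib using su
          by (intro Henstock_Kurzweil_Integration.integral_diff integrable_continuous_interval continuous_on_exp_quotient contP) auto
        have 1: "norm (integral {s..u} (\<lambda>t. exp (\<i> * complex_of_real (P t)) / complex_of_real t)) \<le> 12"
          unfolding P_def
          using dom True by (intro oscillatory_integral_dominant_monomial[OF su j(1) R]) (auto simp: w_def)
        have 2: "norm (integral {s..u} (\<lambda>t. exp (\<i> * complex_of_real (P (- t))) / complex_of_real t)) \<le> 12"
          unfolding P_def sum_alternating_coeffs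
          using dom True by (intro oscillatory_integral_dominant_monomial[OF su j(1) R]) (auto simp: w_def abs_mult)
        have "norm (integral {s..u} G) \<le> 12 + 12"
          unfolding eqG using 1 2 by (intro norm_triangle_le_diff add_mono) auto
        then show ?thesis using m3 by simp
      next
        case False
        then have le1: "w j t \<le> 1" if "t \<in> {s..u}" for t
          using unit[OF j(1)] that su by (auto simp: w_def)
        have "norm (G t) \<le> 4 / u" if t: "t \<in> {s..u}" for t
        proof -
          have t0: "0 < t" using t su by simp
          have wj0: "0 \<le> w j t" using t0 by (simp add: w_def)
          have "w i t \<le> w j t / real m" if "i \<in> {1..m} - {j}" for i
          proof -
            have "real m \<le> real m ^ 3" using m by (intro self_le_power) auto
            then have "real m \<le> R" using m3 unfolding R by linarith
            then have "real m * w i t \<le> R * w i t" using t0 by (intro mult_right_mono) (auto simp: w_def)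
            also have "\<dots> \<le> w j t" using dom[of i t] that t by auto
            finally show ?thesis using m by (simp add: field_simps)
          qed
          then have "(\<Sum>i\<in>{1..m} - {j}. w i t) \<le> (\<Sum>i\<in>{1..m} - {j}. w j t / real m)"
            by (intro sum_mono) auto
          also have "\<dots> = (real m - 1) * (w j t / real m)" using j(1) m by (simp add: of_nat_diff)
          also have "\<dots> \<le> w j t" using m wj0 by (simp add: field_simps)
          finally have "(\<Sum>i=1..m. w i t) \<le> 2 * w j t"
            using j(1) by (subst sum.remove[of _ j]) auto
          moreover have "w j t \<le> t / u"
          proof -
            have "(t / u) ^ j \<le> t / u"
              using power_decreasing[of 1 j "t / u"] j(1) t su by simp
            moreover have "w j t = w j u * (t / u) ^ j" using su by (simp add: w_def power_divide)
            moreover have "w j u * (t / u) ^ j \<le> 1 * (t / u) ^ j"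
              using le1[of u] su t by (intro mult_right_mono) auto
            ultimately show ?thesis by simp
          qed
          ultimately have "2 * (\<Sum>i=1..m. w i t) / t \<le> 4 * (t / u) / t"
            using t0 by (intro divide_right_mono) auto
          then show ?thesis using Gnorm[OF t0] t0 by simp
        qed
        then have "norm (integral {s..u} G) \<le> 4 / u * (u - s)"
          using integral_bound[OF su(2) contG] by blast
        also have "\<dots> \<le> 4" using su by (simp add: field_simps)
        finally show ?thesis using m3 by simp
      qed
    next
      case False
      \<comment> \<open>The monomial \<open>j\<close> that is largest at \<open>s\<close> fails to dominate some \<open>i\<close>. As \<open>i\<close> does not dominate
        \<open>j\<close> either, the two are comparable on the whole interval.\<close>
      then obtain i t where i: "i \<in> {1..m}" "i \<noteq> j" and t: "t \<in> {s..u}" "\<not> R * w i t \<le> w j t"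
        using j(1) aj by auto
      then have ij: "\<forall>t\<in>{s..u}. w j t \<le> R * w i t"
        using pair[OF i(1) j(1) i(2)] unfolding w_def by blast
      have wjs: "0 < w j s" using aj su by (simp add: w_def)
      have "\<not> R * w j s \<le> w i s"
        using j(2)[OF i(1)] wjs R2 mult_right_mono[of 2 R "w j s"] by linarith
      then have ji: "\<forall>t\<in>{s..u}. w i t \<le> R * w j t"
        using pair[OF j(1) i(1)] i(2) su unfolding w_def by auto
      have wis: "0 < w i s" using ij wjs su R2 by (smt (verit) atLeastAtMost_iff mult_nonneg_nonpos)
      then have ai: "a i \<noteq> 0" by (auto simp: w_def)
      have us: "u \<le> R\<^sup>2 * s"
        using ij ji su R2 ai aj i(2)
        by (intro comparable_monomials_imp_short[of s u R "\<bar>a i\<bar>" "\<bar>a j\<bar>" i j]) (auto simp: w_def)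
      have "norm (integral {s..u} G) \<le> 2 * ln u - 2 * ln s"
      proof (rule norm_integral_le_antiderivative[OF su(2) intG, where g = "\<lambda>t. 2 / t"])
        fix t assume t: "t \<in> {s..u}"
        then show "norm (G t) \<le> 2 / t"
          using norm_exp_i_diff_le_2 su by (simp add: G_def norm_divide divide_right_mono)
        show "((\<lambda>t. 2 * ln t) has_real_derivative 2 / t) (at t)"
          using t su by (auto intro!: derivative_eq_intros)
      qed
      also have "\<dots> \<le> 4 * ln R"
      proof -
        have "ln u \<le> ln (R\<^sup>2 * s)" using us su R2 by simp
        also have "\<dots> = 2 * ln R + ln s" using su R2 by (simp add: ln_mult ln_realpow)
        finally show ?thesis by simp
      qed
      also have "\<dots> \<le> 4 * R" using R2 ln_le_minus_one[of R] by simp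
      also have "\<dots> \<le> 32 * real m ^ 3" using R by simp
      finally show ?thesis .
    qed
  qed
  then show ?thesis unfolding G_def .
qed

text \<open>
  This is a Stein--Wainger type estimate. Its points are the independence of the coefficients and
  of \<open>\<epsilon>\<close>, \<open>\<delta>\<close>, and the polynomial growth in \<open>m\<close>; the exponent \<open>5\<close> is far from optimal,
  but any power of the degree is negligible against \<open>ln x\<close> in the application.
\<close>

lemma symmetric_polynomial_integral_bound:
  fixes a :: "nat \<Rightarrow> real" and m :: nat
  defines "P \<equiv> (\<lambda>t. \<Sum>i\<le>m. a i * t ^ i)"
  assumes \<epsilon>: "0 < \<epsilon>" "\<epsilon> \<le> \<delta>" and m: "1 \<le> m"
  shows "norm (integral {\<epsilon>..\<delta>} (\<lambda>t. (exp (\<i> * complex_of_real (P t)) - exp (\<i> * complex_of_real (P (- t)))) / complex_of_real t))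
     \<le> 96 * real m ^ 5"
proof -
  define R where "R = 2 * real m ^ 3"
  define G where "G = (\<lambda>t. (exp (\<i> * complex_of_real (P t)) - exp (\<i> * complex_of_real (P (- t)))) / complex_of_real t)"
  have Rpos: "0 < R" using m by (simp add: R_def)
  \<comment> \<open>\<open>B1\<close> collects the solutions \<open>t\<close> of \<open>\<bar>a j\<bar> t\<^sup>j = R \<bar>a i\<bar> t\<^sup>i\<close>, \<open>B2\<close> those of \<open>\<bar>a j\<bar> t\<^sup>j = 1\<close>.
    Degenerate coefficients only add harmless points.\<close>
  define B1 where "B1 = (\<lambda>(i, j). (R * \<bar>a i\<bar> / \<bar>a j\<bar>) powr (1 / (real j - real i))) ` ({1..m} \<times> {1..m})"
  define B2 where "B2 = (\<lambda>j. (1 / \<bar>a j\<bar>) powr (1 / real j)) ` {1..m}"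
  have root: "x = y powr (1 / p)" if "0 < x" "x powr p = y" "p \<noteq> 0" for x y p :: real
    using that by (auto simp: powr_powr)
  have B1: "t \<in> B1" if "i \<in> {1..m}" "j \<in> {1..m}" "i \<noteq> j" "0 < t" "a j \<noteq> 0"
      "\<bar>a j\<bar> * t ^ j = R * (\<bar>a i\<bar> * t ^ i)" for i j t
  proof -
    have "t powr (real j - real i) = t ^ j / t ^ i" using that by (simp add: powr_diff powr_realpow)
    also have "\<dots> = R * \<bar>a i\<bar> / \<bar>a j\<bar>" using that by (simp add: field_simps)
    finally have "t = (R * \<bar>a i\<bar> / \<bar>a j\<bar>) powr (1 / (real j - real i))" using that by (intro root) auto
    then show ?thesis unfolding B1_def using that by (intro image_eqI[of _ _ "(i, j)"]) auto
  qed
  have B2: "t \<in> B2" if "j \<in> {1..m}" "0 < t" "\<bar>a j\<bar> * t ^ j = 1" for j t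
  proof -
    have "a j \<noteq> 0" using that by auto
    then have "t powr real j = 1 / \<bar>a j\<bar>" using that by (simp add: powr_realpow field_simps)
    then have "t = (1 / \<bar>a j\<bar>) powr (1 / real j)" using that by (intro root) auto
    then show ?thesis unfolding B2_def using that by blast
  qed
  have fin: "finite (B1 \<union> B2)" by (simp add: B1_def B2_def)
  have "card B1 \<le> m * m" unfolding B1_def by (rule order.trans[OF card_image_le]) auto
  moreover have "card B2 \<le> m" unfolding B2_def by (rule order.trans[OF card_image_le]) auto
  ultimately have card: "card (B1 \<union> B2) \<le> m * m + m" using card_Un_le[of B1 B2] by linarith
  have contG: "continuous_on {\<epsilon>..\<delta>} G"
    unfolding G_def P_def using \<epsilon> by (intro continuous_intros) auto
  have "norm (integral {\<epsilon>..\<delta>} G) \<le> (real (card (B1 \<union> B2)) + 1) * (32 * real m ^ 3)"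
  proof (rule norm_integral_le_breakpoints[OF fin \<epsilon>(2) contG])
    fix s u assume s: "\<epsilon> \<le> s" "s \<le> u" "u \<le> \<delta>" and no: "(B1 \<union> B2) \<inter> {s<..<u} = {}"
    have s0: "0 < s" using s \<epsilon> by simp
    show "norm (integral {s..u} G) \<le> 32 * real m ^ 3"
      unfolding G_def P_def
    proof (rule symmetric_integral_piece[OF s0 s(2) m R_def])
      fix i j assume ij: "i \<in> {1..m}" "j \<in> {1..m}" "i \<noteq> j"
      show "(\<forall>t\<in>{s..u}. R * (\<bar>a i\<bar> * t ^ i) \<le> \<bar>a j\<bar> * t ^ j) \<or> (\<forall>t\<in>{s..u}. \<bar>a j\<bar> * t ^ j \<le> R * (\<bar>a i\<bar> * t ^ i))"
      proof (cases "a j = 0")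
        case True
        then show ?thesis using s0 Rpos by auto
      next
        case False
        define q where "q = (\<lambda>t. \<bar>a j\<bar> * t ^ j - R * (\<bar>a i\<bar> * t ^ i))"
        have "q t \<noteq> 0" if "s < t" "t < u" for t
        proof
          assume "q t = 0"
          then have "t \<in> B1" using B1[OF ij _ False] that s0 by (simp add: q_def)
          then show False using no that by auto
        qed
        moreover have "continuous_on {s..u} q" unfolding q_def by (intro continuous_intros)
        ultimately have "(\<forall>t\<in>{s..u}. 0 \<le> q t) \<or> (\<forall>t\<in>{s..u}. q t \<le> 0)"
          by (intro no_zero_imp_sign_constant)
        then show ?thesis by (simp add: q_def)
      qed
    next
      fix j assume j: "j \<in> {1..m}"
      define q where "q = (\<lambda>t. \<bar>a j\<bar> * t ^ j - 1)"
      have "q t \<noteq> 0" if "s < t" "t < u" for t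
      proof
        assume "q t = 0"
        then have "t \<in> B2" using B2[OF j] that s0 by (simp add: q_def)
        then show False using no that by auto
      qed
      moreover have "continuous_on {s..u} q" unfolding q_def by (intro continuous_intros)
      ultimately have "(\<forall>t\<in>{s..u}. 0 \<le> q t) \<or> (\<forall>t\<in>{s..u}. q t \<le> 0)"
        by (intro no_zero_imp_sign_constant)
      then show "(\<forall>t\<in>{s..u}. 1 \<le> \<bar>a j\<bar> * t ^ j) \<or> (\<forall>t\<in>{s..u}. \<bar>a j\<bar> * t ^ j \<le> 1)"
        by (simp add: q_def)
    qed
  qed
  also have "\<dots> \<le> (3 * real m ^ 2) * (32 * real m ^ 3)"
  proof (rule mult_right_mono)
    have "real (card (B1 \<union> B2)) \<le> real (m * m + m)" using card by (rule of_nat_mono)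
    also have "\<dots> = real m ^ 2 + real m" by (simp add: power2_eq_square)
    finally have "real (card (B1 \<union> B2)) \<le> real m ^ 2 + real m" .
    moreover have "real m \<le> real m ^ 2" "1 \<le> real m" using m by (auto intro!: self_le_power)
    ultimately show "real (card (B1 \<union> B2)) + 1 \<le> 3 * real m ^ 2" by linarith
  qed simp
  also have "\<dots> = 96 * real m ^ 5" by (simp flip: power_add)
  finally show ?thesis unfolding G_def .
qed

section \<open>The principal value and Taylor approximation\<close>

text \<open>
  Folding the negative half of the domain onto the positive one turns the kernel into a difference
  quotient at \<open>0\<close>, which extends continuously; so the truncated integrals converge.
\<close>

lemma pv_oscillatory_tendsto:
  fixes \<psi> :: "real \<Rightarrow> real"
  assumes cont: "continuous_on {-1..1} \<psi>" and d: "(\<psi> has_real_derivative d) (at 0)"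
  shows "((\<lambda>\<epsilon>. integral {\<epsilon>..1} (\<lambda>t. (exp (\<i> * complex_of_real (x * \<psi> t)) - exp (\<i> * complex_of_real (x * \<psi> (- t)))) / complex_of_real t))
     \<longlongrightarrow> pv_oscillatory \<psi> x) (at_right 0)"
proof -
  define F where "F = (\<lambda>t. exp (\<i> * complex_of_real (x * \<psi> t)))"
  define H where "H = (\<lambda>t. F t - F (- t))"
  have contF: "continuous_on {-1..1} F" unfolding F_def using cont by (intro continuous_intros)
  have contF': "continuous_on {-1..1} (\<lambda>t. F (- t))"
    by (rule continuous_on_compose2[OF contF]) (auto intro: continuous_intros)
  have "((\<lambda>t. \<i> * complex_of_real (x * \<psi> t)) has_vector_derivative \<i> * complex_of_real (x * d)) (at 0)"
    using d by (auto intro!: derivative_eq_intros simp: has_real_derivative_iff_has_vector_derivative)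
  from field_vector_diff_chain_at[OF this DERIV_exp]
  have F': "(F has_vector_derivative \<i> * complex_of_real (x * d) * F 0) (at 0)"
    by (simp add: F_def o_def)
  have "((\<lambda>t. F (- t)) has_vector_derivative (- 1) *\<^sub>R (\<i> * complex_of_real (x * d) * F 0)) (at 0)"
    using vector_diff_chain_at[of uminus "-1" 0 F] F'
    by (force simp: o_def intro!: derivative_eq_intros)
  then obtain H0 where H': "(H has_vector_derivative H0) (at 0)"
    unfolding H_def using has_vector_derivative_diff[OF F'] by blast
  \<comment> \<open>\<open>G0\<close> is the symmetrised kernel with its continuous value at \<open>0\<close>.\<close>
  define G0 where "G0 = (\<lambda>t. if t = 0 then H0 else H t / complex_of_real t)"
  have "((\<lambda>y. norm ((H y - H 0) - (y - 0) *\<^sub>R H0) / norm (y - 0)) \<longlongrightarrow> 0) (at 0)"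
    using H' unfolding has_vector_derivative_def has_derivative_iff_norm by blast
  then have "((\<lambda>y. norm (G0 y - H0)) \<longlongrightarrow> 0) (at 0)"
  proof (rule Lim_transform_eventually)
    have "norm (H y - H 0 - (y - 0) *\<^sub>R H0) / norm (y - 0) = norm (G0 y - H0)" if "y \<noteq> 0" for y
    proof -
      have "G0 y - H0 = (H y - y *\<^sub>R H0) / complex_of_real y"
        using that by (simp add: G0_def field_simps scaleR_conv_of_real)
      moreover have "H 0 = 0" by (simp add: H_def)
      ultimately show ?thesis by (simp add: norm_divide)
    qed
    then show "\<forall>\<^sub>F y in at 0. norm (H y - H 0 - (y - 0) *\<^sub>R H0) / norm (y - 0) = norm (G0 y - H0)"
      by (auto simp: eventually_at_filter)
  qed
  then have "(G0 \<longlongrightarrow> G0 0) (at 0)"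
    by (simp add: tendsto_norm_zero_iff LIM_zero_iff G0_def)
  then have at0: "continuous (at 0 within {0..1}) G0"
    using continuous_at_imp_continuous_within[of 0 G0] by (simp add: continuous_at)
  have contq: "continuous_on {0<..1} (\<lambda>t. H t / complex_of_real t)"
    unfolding H_def
    by (intro continuous_intros continuous_on_subset[OF contF] continuous_on_subset[OF contF']) auto
  have contG: "continuous_on {0..1} G0"
    unfolding continuous_on_eq_continuous_within
  proof
    fix t :: real assume t: "t \<in> {0..1}"
    show "continuous (at t within {0..1}) G0"
    proof (cases "t = 0")
      case False
      have "continuous (at t within {0<..1}) (\<lambda>t. H t / complex_of_real t)"
        using contq t False by (simp add: continuous_on_eq_continuous_within)
      moreover have "at t within {0<..1} = at t within {0..1}"
        using t False by (intro at_within_nhd[of t "{0<..}"]) auto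
      ultimately have "continuous (at t within {0..1}) (\<lambda>t. H t / complex_of_real t)" by simp
      then show ?thesis
        by (rule continuous_transform_within[of _ _ _ t]) (use t False in \<open>auto simp: G0_def dist_real_def\<close>)
    qed (use at0 in simp)
  qed
  then have "continuous_on {0..1} (\<lambda>\<epsilon>. integral {\<epsilon>..1} G0)"
    by (intro indefinite_integral_continuous_1' integrable_continuous_interval)
  then have "((\<lambda>\<epsilon>. integral {\<epsilon>..1} G0) \<longlongrightarrow> integral {0..1} G0) (at 0 within {0..1})"
    by (simp add: continuous_on_def)
  then have lim0: "((\<lambda>\<epsilon>. integral {\<epsilon>..1} G0) \<longlongrightarrow> integral {0..1} G0) (at_right 0)"
    by (simp add: at_within_Icc_at_right)
  have ev: "\<forall>\<^sub>F \<epsilon> in at_right 0. (\<epsilon>::real) \<in> {0<..<1}" by (rule eventually_at_right_real) simp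
  have lim1: "((\<lambda>\<epsilon>. integral {\<epsilon>..1} (\<lambda>t. H t / complex_of_real t)) \<longlongrightarrow> integral {0..1} G0) (at_right 0)"
    using lim0
  proof (rule Lim_transform_eventually)
    show "\<forall>\<^sub>F \<epsilon> in at_right 0. integral {\<epsilon>..1} G0 = integral {\<epsilon>..1} (\<lambda>t. H t / complex_of_real t)"
      using ev by eventually_elim (auto intro!: integral_cong simp: G0_def)
  qed
  have split: "integral {t. \<epsilon> \<le> \<bar>t\<bar> \<and> \<bar>t\<bar> \<le> 1} (\<lambda>t. F t / complex_of_real t) =
      integral {\<epsilon>..1} (\<lambda>t. H t / complex_of_real t)" if \<epsilon>: "0 < \<epsilon>" "\<epsilon> < 1" for \<epsilon>
  proof -
    have i1: "(\<lambda>t. F t / complex_of_real t) integrable_on {\<epsilon>..1}"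
      using \<epsilon> by (intro integrable_continuous_interval continuous_intros continuous_on_subset[OF contF]) auto
    have i2: "(\<lambda>t. F (- t) / complex_of_real t) integrable_on {\<epsilon>..1}"
      using \<epsilon> by (intro integrable_continuous_interval continuous_intros continuous_on_subset[OF contF']) auto
    define A B where "A = integral {\<epsilon>..1} (\<lambda>t. F t / complex_of_real t)"
      and "B = integral {\<epsilon>..1} (\<lambda>t. F (- t) / complex_of_real t)"
    have "((\<lambda>t. - (F (- t) / complex_of_real t)) has_integral - B) {\<epsilon>..1}"
      using integrable_integral[OF i2] unfolding B_def by (rule has_integral_neg)
    then have "((\<lambda>t. F t / complex_of_real t) has_integral - B) {-1..-\<epsilon>}"
      using has_integral_reflect_real[of "\<lambda>t. - (F (- t) / complex_of_real t)" "- B" 1 \<epsilon>] by simp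
    moreover have "((\<lambda>t. F t / complex_of_real t) has_integral A) {\<epsilon>..1}"
      using integrable_integral[OF i1] by (simp add: A_def)
    moreover have "{-1..-\<epsilon>} \<inter> {\<epsilon>..1} = {}" using \<epsilon> by auto
    ultimately have "((\<lambda>t. F t / complex_of_real t) has_integral - B + A) ({-1..-\<epsilon>} \<union> {\<epsilon>..1})"
      by (intro has_integral_Un) auto
    moreover have "{-1..-\<epsilon>} \<union> {\<epsilon>..1} = {t. \<epsilon> \<le> \<bar>t\<bar> \<and> \<bar>t\<bar> \<le> 1}" using \<epsilon> by auto
    ultimately have "integral {t. \<epsilon> \<le> \<bar>t\<bar> \<and> \<bar>t\<bar> \<le> 1} (\<lambda>t. F t / complex_of_real t) = - B + A"
      by (auto intro: integral_unique)
    also have "\<dots> = integral {\<epsilon>..1} (\<lambda>t. H t / complex_of_real t)"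
      unfolding H_def A_def B_def diff_divide_distrib using i1 i2
      by (simp add: Henstock_Kurzweil_Integration.integral_diff)
    finally show ?thesis .
  qed
  have "((\<lambda>\<epsilon>. integral {t. \<epsilon> \<le> \<bar>t\<bar> \<and> \<bar>t\<bar> \<le> 1} (\<lambda>t. F t / complex_of_real t)) \<longlongrightarrow> integral {0..1} G0) (at_right 0)"
    using lim1
  proof (rule Lim_transform_eventually)
    show "\<forall>\<^sub>F \<epsilon> in at_right 0. integral {\<epsilon>..1} (\<lambda>t. H t / complex_of_real t)
        = integral {t. \<epsilon> \<le> \<bar>t\<bar> \<and> \<bar>t\<bar> \<le> 1} (\<lambda>t. F t / complex_of_real t)"
      using ev by eventually_elim (simp add: split)
  qed
  then have "pv_oscillatory \<psi> x = integral {0..1} G0"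
    unfolding pv_oscillatory_def F_def by (intro tendsto_Lim) auto
  then show ?thesis using lim1 by (simp add: H_def F_def)
qed

text \<open>
  The cut-off \<open>\<delta>\<close> separates two regimes. For \<open>\<bar>t\<bar> \<ge> \<delta>\<close> the trivial bound \<open>2 / t\<close> costs
  \<open>2 ln (1 / \<delta>)\<close>. For \<open>\<bar>t\<bar> \<le> \<delta>\<close> the phase is its Taylor polynomial of degree less than \<open>n\<close> up
  to an error of at most \<open>x C t\<^sup>n\<close>, so the polynomial estimate applies and the error adds \<open>2\<close>.
\<close>

lemma pv_oscillatory_Taylor_bound:
  fixes \<psi> :: "real \<Rightarrow> real" and D :: "nat \<Rightarrow> real \<Rightarrow> real"
  assumes cont: "continuous_on {-1..1} \<psi>" and D0: "D 0 = \<psi>"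
    and D: "\<And>i t. \<bar>t\<bar> < 1 \<Longrightarrow> (D i has_real_derivative D (Suc i) t) (at t)"
    and bound: "\<And>t. \<bar>t\<bar> < 1 \<Longrightarrow> \<bar>D n t\<bar> \<le> C"
    and n: "1 \<le> n" and x: "0 < x" and \<delta>: "0 < \<delta>" "\<delta> < 1" "x * C * \<delta> ^ n \<le> 1"
  shows "norm (pv_oscillatory \<psi> x) \<le> 2 + 96 * real n ^ 5 + 2 * ln (1 / \<delta>)"
proof -
  define G where "G = (\<lambda>t. (exp (\<i> * complex_of_real (x * \<psi> t)) - exp (\<i> * complex_of_real (x * \<psi> (- t)))) / complex_of_real t)"
  \<comment> \<open>The Taylor polynomial has degree less than \<open>n\<close>; the zero coefficient at \<open>n\<close> makes the nominal
    degree at least \<open>1\<close>.\<close>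
  define a where "a = (\<lambda>i. if i < n then x * (D i 0 / fact i) else 0)"
  define P where "P = (\<lambda>t. \<Sum>i\<le>n. a i * t ^ i)"
  define Gp where "Gp = (\<lambda>t. (exp (\<i> * complex_of_real (P t)) - exp (\<i> * complex_of_real (P (- t)))) / complex_of_real t)"
  have C0: "0 \<le> C" using bound[of 0] by simp
  have P_eq: "P t = x * (\<Sum>i<n. D i 0 / fact i * t ^ i)" for t
  proof -
    have "P t = (\<Sum>i<n. x * (D i 0 / fact i) * t ^ i)"
      unfolding P_def a_def by (rule sum.mono_neutral_cong_right) auto
    then show ?thesis by (simp add: sum_distrib_left mult_ac)
  qed
  have taylor: "\<bar>x * \<psi> t - P t\<bar> \<le> x * C * \<bar>t\<bar> ^ n" if t: "\<bar>t\<bar> < 1" for t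
  proof -
    obtain s where s: "\<bar>s\<bar> \<le> \<bar>t\<bar>" "\<psi> t = (\<Sum>i<n. D i 0 / fact i * t ^ i) + D n s / fact n * t ^ n"
      using Maclaurin_bi_le[of D \<psi> n t] D0 D t by auto
    have "\<bar>x * \<psi> t - P t\<bar> = x * \<bar>D n s\<bar> / fact n * \<bar>t\<bar> ^ n"
      using x by (simp add: s(2) P_eq algebra_simps abs_mult power_abs)
    also have "\<dots> \<le> x * C / 1 * \<bar>t\<bar> ^ n"
      using bound[of s] s(1) t x C0 by (intro mult_right_mono frac_le mult_left_mono) auto
    finally show ?thesis by simp
  qed
  have contrefl: "continuous_on {-1..1} (\<lambda>t. \<psi> (- t))"
    by (rule continuous_on_compose2[OF cont]) (auto intro: continuous_intros)
  have contG: "continuous_on {\<epsilon>..1} G" if "0 < \<epsilon>" for \<epsilon>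
    unfolding G_def using that
    by (intro continuous_intros continuous_on_subset[OF cont] continuous_on_subset[OF contrefl]) auto
  have contGp: "continuous_on {\<epsilon>..1} Gp" if "0 < \<epsilon>" for \<epsilon>
    unfolding Gp_def P_def using that by (intro continuous_intros) auto
  have bd: "norm (integral {\<epsilon>..1} G) \<le> 2 + 96 * real n ^ 5 + 2 * ln (1 / \<delta>)" if \<epsilon>: "\<epsilon> \<in> {0<..<\<delta>}" for \<epsilon>
  proof -
    have iG: "G integrable_on {s..u}" if "0 < s" "u \<le> 1" for s u
      using contG[OF that(1)] that by (intro integrable_continuous_interval) (auto intro: continuous_on_subset)
    have iGp: "Gp integrable_on {s..u}" if "0 < s" "u \<le> 1" for s u
      using contGp[OF that(1)] that by (intro integrable_continuous_interval) (auto intro: continuous_on_subset)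
    have 1: "norm (integral {\<delta>..1} G) \<le> 2 * ln 1 - 2 * ln \<delta>"
    proof (rule norm_integral_le_antiderivative[where g = "\<lambda>t. 2 / t"])
      fix t assume t: "t \<in> {\<delta>..1}"
      then show "norm (G t) \<le> 2 / t"
        using norm_exp_i_diff_le_2[of "x * \<psi> t" "x * \<psi> (- t)"] \<delta> by (simp add: G_def norm_divide divide_right_mono)
      show "((\<lambda>t. 2 * ln t) has_real_derivative 2 / t) (at t)"
        using t \<delta> by (auto intro!: derivative_eq_intros)
    qed (use \<delta> iG in auto)
    have 2: "norm (integral {\<epsilon>..\<delta>} Gp) \<le> 96 * real n ^ 5"
      unfolding Gp_def P_def using \<epsilon> n by (intro symmetric_polynomial_integral_bound) auto
    have 3: "norm (integral {\<epsilon>..\<delta>} (\<lambda>t. G t - Gp t)) \<le> 2"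
    proof -
      have "norm (G t - Gp t) \<le> 2 / \<delta>" if t: "t \<in> {\<epsilon>..\<delta>}" for t
      proof -
        have t0: "0 < t" "t \<le> \<delta>" "\<bar>t\<bar> < 1" using t \<epsilon> \<delta> by auto
        have "G t - Gp t = ((exp (\<i> * complex_of_real (x * \<psi> t)) - exp (\<i> * complex_of_real (P t)))
           - (exp (\<i> * complex_of_real (x * \<psi> (- t))) - exp (\<i> * complex_of_real (P (- t))))) / complex_of_real t"
          unfolding G_def Gp_def by (simp flip: diff_divide_distrib)
        then have "norm (G t - Gp t) = norm ((exp (\<i> * complex_of_real (x * \<psi> t)) - exp (\<i> * complex_of_real (P t)))
           - (exp (\<i> * complex_of_real (x * \<psi> (- t))) - exp (\<i> * complex_of_real (P (- t))))) / t"
          using t0 by (simp add: norm_divide)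
        also have "\<dots> \<le> (x * C * t ^ n + x * C * t ^ n) / t"
        proof (intro divide_right_mono order.trans[OF norm_triangle_ineq4 add_mono])
          show "norm (exp (\<i> * complex_of_real (x * \<psi> t)) - exp (\<i> * complex_of_real (P t))) \<le> x * C * t ^ n"
            using norm_exp_i_diff_le[of "x * \<psi> t" "P t"] taylor[of t] t0 by simp
          show "norm (exp (\<i> * complex_of_real (x * \<psi> (- t))) - exp (\<i> * complex_of_real (P (- t)))) \<le> x * C * t ^ n"
            using norm_exp_i_diff_le[of "x * \<psi> (- t)" "P (- t)"] taylor[of "- t"] t0 by simp
        qed (use t0 in simp)
        also have "\<dots> = 2 * (x * C) * t ^ (n - 1)" using n t0 by (cases n) auto
        also have "\<dots> \<le> 2 * (x * C) * \<delta> ^ (n - 1)" using t0 x C0 by (intro mult_left_mono power_mono) auto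
        also have "\<dots> = 2 * (x * C * \<delta> ^ n) / \<delta>" using n \<delta> by (cases n) auto
        also have "\<dots> \<le> 2 * 1 / \<delta>" using \<delta> by (intro divide_right_mono mult_left_mono) auto
        finally show ?thesis by simp
      qed
      then have "norm (integral {\<epsilon>..\<delta>} (\<lambda>t. G t - Gp t)) \<le> 2 / \<delta> * (\<delta> - \<epsilon>)"
        using \<epsilon> \<delta> contG[of \<epsilon>] contGp[of \<epsilon>]
        by (intro integral_bound continuous_intros) (auto intro: continuous_on_subset)
      also have "\<dots> \<le> 2" using \<epsilon> \<delta> by (simp add: field_simps)
      finally show ?thesis .
    qed
    have "integral {\<epsilon>..1} G = integral {\<epsilon>..\<delta>} G + integral {\<delta>..1} G"
      using \<epsilon> \<delta> iG by (intro Henstock_Kurzweil_Integration.integral_combine[symmetric]) auto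
    also have "integral {\<epsilon>..\<delta>} G = integral {\<epsilon>..\<delta>} (\<lambda>t. G t - Gp t) + integral {\<epsilon>..\<delta>} Gp"
      using \<epsilon> \<delta> iG[of \<epsilon> \<delta>] iGp[of \<epsilon> \<delta>] by (simp add: Henstock_Kurzweil_Integration.integral_diff)
    finally have "norm (integral {\<epsilon>..1} G) \<le> (2 + 96 * real n ^ 5) + (2 * ln 1 - 2 * ln \<delta>)"
      using 1 2 3 by (metis norm_triangle_mono)
    then show ?thesis using \<delta> by (simp add: ln_div)
  qed
  have "((\<lambda>\<epsilon>. norm (integral {\<epsilon>..1} G)) \<longlongrightarrow> norm (pv_oscillatory \<psi> x)) (at_right 0)"
    unfolding G_def using D[of 0 0] D0 by (intro tendsto_norm pv_oscillatory_tendsto[OF cont]) auto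
  then show ?thesis
    by (rule tendsto_upperbound)
       (use bd in \<open>auto intro!: eventually_mono[OF eventually_at_right_real[OF \<delta>(1)]]\<close>)
qed

section \<open>Iterated exponentials and logarithms\<close>

lemma iter_exp_Suc: "iter_exp (Suc k) x = exp (iter_exp k x)"
  by (simp only: funpow.simps o_apply)

lemma le_iter_exp: "y \<le> iter_exp k y"
proof (induction k)
  case 0
  show ?case by (simp only: funpow.simps id_apply order_refl)
next
  case (Suc k)
  note Suc.IH
  also have "iter_exp k y \<le> exp (iter_exp k y)"
    by (rule order.trans[OF _ exp_ge_add_one_self]) simp
  finally show ?case by (simp only: iter_exp_Suc)
qed

lemma exp_le_iter_exp: "1 \<le> k \<Longrightarrow> exp y \<le> iter_exp k y"
proof (cases k)
  case (Suc k')
  then show ?thesis using le_iter_exp[of y k'] by (simp only: iter_exp_Suc exp_le_cancel_iff)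
qed simp

lemma iter_exp_mono: "y \<le> z \<Longrightarrow> iter_exp k y \<le> iter_exp k z"
  by (induction k) simp_all

lemma iter_log_Suc: "iter_log (Suc k) x = iter_log k (ln x)"
  by (simp only: funpow_Suc_right o_apply)

text \<open>
  The lower bound on \<open>x\<close> makes every intermediate logarithm positive except possibly the last,
  which need only be nonnegative; so each \<open>ln\<close> is a genuine inverse of \<open>exp\<close>.
\<close>

lemma iter_exp_iter_log: "iter_exp k 0 \<le> x \<Longrightarrow> iter_exp k (iter_log k x) = x"
proof (induction k arbitrary: x)
  case (Suc k)
  then have x: "exp (iter_exp k 0) \<le> x" by simp
  then have x0: "0 < x" by (meson exp_gt_zero less_le_trans)
  then have "iter_exp k 0 \<le> ln x" using x by (simp add: ln_ge_iff)
  then have "iter_exp k (iter_log k (ln x)) = ln x" by (rule Suc.IH)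
  then have "exp (iter_exp k (iter_log (Suc k) x)) = x" using x0 by (simp add: iter_log_Suc del: funpow.simps)
  then show ?case by simp
qed simp

lemma iter_exp_le_imp_le_iter_log: "iter_exp k y \<le> x \<Longrightarrow> y \<le> iter_log k x"
proof (induction k arbitrary: x)
  case (Suc k)
  then have x: "exp (iter_exp k y) \<le> x" by simp
  then have x0: "0 < x" by (meson exp_gt_zero less_le_trans)
  then have "iter_exp k y \<le> ln x" using x by (simp add: ln_ge_iff)
  then show ?case using Suc.IH by (simp add: iter_log_Suc del: funpow.simps)
qed simp

lemma filterlim_iter_log_at_top: "filterlim (iter_log k) at_top at_top"
proof (induction k)
  case (Suc k)
  then show ?case using filterlim_compose[OF ln_at_top Suc] by (simp only: funpow.simps o_def)
qed (simp only: funpow.simps id_def filterlim_ident)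

lemma eventually_power_le_exp_powr:
  assumes "0 < c" "0 < \<alpha>"
  shows "\<forall>\<^sub>F n::nat in sequentially. real n ^ p \<le> exp (c * real n powr \<alpha>)"
proof -
  have "((\<lambda>n. ln (real n) / real n powr \<alpha>) \<longlongrightarrow> 0) sequentially"
    by (rule lim_ln_over_power[OF assms(2)])
  then have "\<forall>\<^sub>F n in sequentially. ln (real n) / real n powr \<alpha> < c / (real p + 1)"
    using assms by (intro order_tendstoD(2)) auto
  then show ?thesis using eventually_gt_at_top[of 0]
  proof eventually_elim
    case (elim n)
    have "ln (real n) \<le> c / (real p + 1) * real n powr \<alpha>" using elim by (simp add: field_simps)
    then have "real p * ln (real n) \<le> real p * (c / (real p + 1) * real n powr \<alpha>)" by (intro mult_left_mono) auto
    also have "\<dots> = (real p / (real p + 1)) * (c * real n powr \<alpha>)" by simp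
    also have "\<dots> \<le> 1 * (c * real n powr \<alpha>)" using assms by (intro mult_right_mono) auto
    finally have "ln (real n ^ p) \<le> c * real n powr \<alpha>" using elim by (simp add: ln_realpow)
    then have "exp (ln (real n ^ p)) \<le> exp (c * real n powr \<alpha>)" by (simp only: exp_le_cancel_iff)
    then show ?case using elim(2) by (simp only: exp_ln zero_less_power of_nat_0_less_iff)
  qed
qed

lemma filterlim_powr_at_top:
  fixes p :: real
  assumes "0 < p"
  shows "filterlim (\<lambda>x. x powr p) at_top at_top"
proof -
  have "filterlim (\<lambda>x::real. exp (p * ln x)) at_top at_top"
    using assms
    by (intro filterlim_compose[OF exp_at_top] filterlim_tendsto_pos_mult_at_top[OF tendsto_const _ ln_at_top])
  moreover have "\<forall>\<^sub>F x::real in at_top. exp (p * ln x) = x powr p"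
    using eventually_gt_at_top[of 0] by eventually_elim (simp add: powr_def)
  ultimately show ?thesis by (rule filterlim_cong[OF refl refl, THEN iffD1, rotated])
qed

section \<open>The upper bound\<close>

lemma nth_derivative_on_has_derivative:
  assumes "smooth_on S f" "t \<in> interior S"
  shows "(nth_derivative_on S i f has_real_derivative nth_derivative_on S (Suc i) f t) (at t)"
proof -
  have at: "at t within S = at t" using assms(2) by (rule at_within_interior)
  have "t \<in> S" using assms(2) interior_subset by blast
  then have "nth_derivative_on S i f differentiable (at t within S)"
    using assms(1) unfolding smooth_on_def differentiable_on_def by blast
  then have "(nth_derivative_on S i f has_vector_derivative nth_derivative_on S (Suc i) f t) (at t within S)"
    unfolding nth_derivative_on.simps by (rule vector_derivative_works[THEN iffD1])
  then show ?thesis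
    unfolding at by (rule has_real_derivative_iff_has_vector_derivative[THEN iffD2])
qed

text \<open>
  The number \<open>x\<close> plays a double role: it is the frequency, and it bounds \<open>M\<^sub>n\<close>. Hence \<open>n\<close> can be
  taken as large as \<open>M\<^sub>n \<le> x\<close> permits, and then \<open>ln (1 / \<delta>)\<close> is about \<open>2 ln x / n\<close>.
\<close>

lemma carleman_class_pv_bound:
  assumes f: "smooth_on {-1..1} \<psi>" and K: "1 \<le> K"
    and bound: "\<And>t. t \<in> {-1..1} \<Longrightarrow> \<bar>nth_derivative_on {-1..1} n \<psi> t\<bar> \<le> K ^ (n + 1) * x"
    and n: "1 \<le> n" and x: "1 < x"
  shows "norm (pv_oscillatory \<psi> x) \<le> 2 + 96 * real n ^ 5 + 4 * (ln x / real n) + 4 * ln K"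
proof -
  define T where "T = x\<^sup>2 * K ^ (n + 1)"
  \<comment> \<open>\<open>\<delta>\<close> solves \<open>x (K\<^bsup>n + 1\<^esup> x) \<delta>\<^sup>n = 1\<close>.\<close>
  define \<delta> where "\<delta> = T powr (- 1 / real n)"
  have Kn: "1 \<le> K ^ (n + 1)" using K by (rule one_le_power)
  have x2: "1 < x\<^sup>2" using x by (simp add: power2_eq_square less_1_mult)
  have T: "1 < T" unfolding T_def using Kn x2 mult_left_mono[of 1 "K ^ (n+1)" "x\<^sup>2"] by linarith
  have \<delta>: "0 < \<delta>" "\<delta> < 1" using T n powr_less_mono[of "- 1 / real n" 0 T] by (auto simp: \<delta>_def divide_simps)
  have \<delta>n: "\<delta> ^ n = 1 / T"
  proof -
    have "\<delta> ^ n = T powr (- 1 / real n * real n)" using \<delta> by (simp add: \<delta>_def powr_powr flip: powr_realpow)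
    then show ?thesis using n T by (simp add: powr_minus_divide)
  qed
  have ln\<delta>: "ln (1 / \<delta>) \<le> 2 * (ln x / real n) + 2 * ln K"
  proof -
    have "ln T = 2 * ln x + (real n + 1) * ln K"
      using x K by (simp add: T_def ln_mult ln_realpow distrib_right)
    moreover have "ln \<delta> = - ln T / real n" using T by (simp add: \<delta>_def ln_powr)
    then have "ln (1 / \<delta>) = ln T / real n" using \<delta>(1) by (simp add: ln_div)
    ultimately have "ln (1 / \<delta>) = 2 * ln x / real n + (real n + 1) / real n * ln K"
      by (simp add: add_divide_distrib[of "2 * ln x"])
    moreover have "(real n + 1) / real n * ln K \<le> 2 * ln K"
      using n K by (intro mult_right_mono) (simp_all add: pos_divide_le_eq)
    ultimately show ?thesis by (simp only: times_divide_eq_right)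
  qed
  have cont: "continuous_on {-1..1} \<psi>"
    using f[unfolded smooth_on_def, rule_format, of 0] by (simp add: differentiable_imp_continuous_on)
  have "norm (pv_oscillatory \<psi> x) \<le> 2 + 96 * real n ^ 5 + 2 * ln (1 / \<delta>)"
  proof (rule pv_oscillatory_Taylor_bound[OF cont])
    show "nth_derivative_on {-1..1} 0 \<psi> = \<psi>" by simp
    show "(nth_derivative_on {-1..1} i \<psi> has_real_derivative nth_derivative_on {-1..1} (Suc i) \<psi> t) (at t)"
      if "\<bar>t\<bar> < 1" for i t
      using that by (intro nth_derivative_on_has_derivative[OF f]) auto
    show "\<bar>nth_derivative_on {-1..1} n \<psi> t\<bar> \<le> K ^ (n + 1) * x" if "\<bar>t\<bar> < 1" for t
      using that by (intro bound) auto
    show "x * (K ^ (n + 1) * x) * \<delta> ^ n \<le> 1"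
    proof -
      have "x * (K ^ (n + 1) * x) = T" by (simp only: T_def power2_eq_square mult_ac)
      then show ?thesis using T by (simp only: \<delta>n) simp
    qed
  qed (use n x \<delta> in simp_all)
  with ln\<delta> show ?thesis by linarith
qed

text \<open>
  The largest \<open>n\<close> with \<open>M\<^sub>n \<le> x\<close> is the integer part of \<open>(iter_log k x / c) powr (1 / \<alpha>)\<close>, so the
  main term \<open>ln x / n\<close> is the claimed rate. Because \<open>k \<ge> 2\<close>, \<open>ln x\<close> is at least
  \<open>exp (c * n powr \<alpha>)\<close>, which beats every power of \<open>n\<close> and absorbs the polynomial contribution.
\<close>

lemma carleman_class_pv_bigo:
  fixes c \<alpha> :: real and k :: nat
  assumes c: "c > 0" and \<alpha>: "\<alpha> > 0" and k: "k \<ge> 2"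
    and \<psi>: "\<psi> \<in> carleman_class {-1..1} (\<lambda>n. iter_exp k (c * real n powr \<alpha>))"
  shows "(\<lambda>x. cmod (pv_oscillatory \<psi> x)) \<in> O[at_top](\<lambda>x. ln x / (iter_log k x) powr (1 / \<alpha>))"
proof -
  define M where "M = (\<lambda>n::nat. iter_exp k (c * real n powr \<alpha>))"
  obtain K0 where f: "smooth_on {-1..1} \<psi>" and K0: "0 < K0"
    "\<And>n t. t \<in> {-1..1} \<Longrightarrow> \<bar>nth_derivative_on {-1..1} n \<psi> t\<bar> \<le> K0 ^ (n + 1) * M n"
    using \<psi> by (auto simp: carleman_class_def M_def)
  define K where "K = max 1 K0"
  have K: "1 \<le> K" by (simp add: K_def)
  have Mpos: "0 < M n" for n using k by (cases k) (auto simp: M_def)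
  have KM: "\<bar>nth_derivative_on {-1..1} n \<psi> t\<bar> \<le> K ^ (n + 1) * x" if "t \<in> {-1..1}" "M n \<le> x" for n t x
  proof -
    have "K0 ^ (n + 1) * M n \<le> K ^ (n + 1) * x"
      using K0(1) Mpos[of n] that by (intro mult_mono power_mono) (auto simp: K_def)
    then show ?thesis using K0(2)[OF that(1), of n] by linarith
  qed
  define y where "y = (\<lambda>x. (iter_log k x / c) powr (1 / \<alpha>))"
  define N where "N = (\<lambda>x. nat \<lfloor>y x\<rfloor>)"
  have limy: "filterlim y at_top at_top"
  proof -
    have "filterlim (\<lambda>x. (1 / c) * iter_log k x) at_top at_top"
      using c by (intro filterlim_tendsto_pos_mult_at_top[OF tendsto_const _ filterlim_iter_log_at_top]) auto
    then have "filterlim (\<lambda>x. iter_log k x / c) at_top at_top" by simp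
    then show ?thesis unfolding y_def using \<alpha>
      by (intro filterlim_compose[OF filterlim_powr_at_top]) auto
  qed
  have limN: "filterlim N sequentially at_top"
    unfolding N_def by (intro filterlim_compose[OF filterlim_nat_sequentially] filterlim_compose[OF filterlim_floor_sequentially] limy)
  define A where "A = 102 + 4 * ln K"
  have A: "0 \<le> A" using K by (simp add: A_def)
  have ev: "\<forall>\<^sub>F x in at_top. cmod (pv_oscillatory \<psi> x) \<le> (A * 2 * c powr (1 / \<alpha>)) * norm (ln x / (iter_log k x) powr (1 / \<alpha>))"
    using eventually_ge_at_top[of "iter_exp k 0"] eventually_gt_at_top[of "1::real"]
      filterlim_at_top_dense[THEN iffD1, OF filterlim_iter_log_at_top[of k], rule_format, of 0]
      limy[THEN filterlim_at_top[THEN iffD1], rule_format, of 1]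
      eventually_compose_filterlim[OF eventually_power_le_exp_powr[OF c \<alpha>, of 6] limN]
  proof eventually_elim
    case (elim x)
    define n where "n = N x"
    define w where "w = iter_log k x"
    have w: "0 < w" using elim by (simp add: w_def)
    have n_le: "real n \<le> y x" and n_ge: "y x / 2 \<le> real n" and n1: "1 \<le> n"
    proof -
      have "0 \<le> \<lfloor>y x\<rfloor>" using elim(4) by linarith
      then have "real n = of_int \<lfloor>y x\<rfloor>" by (simp add: n_def N_def)
      moreover have "of_int \<lfloor>y x\<rfloor> \<le> y x" "y x < of_int \<lfloor>y x\<rfloor> + 1" "1 \<le> real_of_int \<lfloor>y x\<rfloor>"
        using elim(4) by (linarith, linarith, simp)
      ultimately show "real n \<le> y x" "y x / 2 \<le> real n" "1 \<le> n" by linarith+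
    qed
    have "real n powr \<alpha> \<le> y x powr \<alpha>" using n_le \<alpha> by (intro powr_mono2) auto
    also have "y x powr \<alpha> = w / c" using w c \<alpha> by (simp add: y_def w_def powr_powr)
    finally have "c * real n powr \<alpha> \<le> w" using c by (simp add: pos_le_divide_eq mult.commute)
    then have "M n \<le> iter_exp k w" unfolding M_def by (rule iter_exp_mono)
    also have "iter_exp k w = x" unfolding w_def by (rule iter_exp_iter_log) (rule elim)
    finally have Mx: "M n \<le> x" .
    obtain k' where k': "k = Suc k'" "1 \<le> k'" using k by (cases k) auto
    \<comment> \<open>The sixth power is what lets \<open>ln x / n\<close> absorb the fifth power from the polynomial estimate.\<close>
    have "real n ^ 6 \<le> exp (c * real n powr \<alpha>)" using elim(5) by (simp add: n_def)
    also have "\<dots> \<le> iter_exp k' (c * real n powr \<alpha>)" by (rule exp_le_iter_exp[OF k'(2)])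
    also have "\<dots> = ln (M n)" by (simp add: M_def k')
    also have "\<dots> \<le> ln x" using Mx Mpos[of n] by simp
    finally have n6: "real n ^ 6 \<le> ln x" .
    have n5: "real n ^ 5 \<le> ln x / real n"
      using n6 n1 by (simp add: pos_le_divide_eq flip: power_Suc2)
    have "1 \<le> real n ^ 5" using n1 by simp
    then have one: "1 \<le> ln x / real n" using n5 by linarith
    then have "ln K * 1 \<le> ln K * (ln x / real n)" using K by (intro mult_left_mono) auto
    then have "2 + 96 * real n ^ 5 + 4 * (ln x / real n) + 4 * ln K \<le> A * (ln x / real n)"
      using n5 one unfolding A_def distrib_right mult.assoc by linarith
    moreover have "cmod (pv_oscillatory \<psi> x) \<le> 2 + 96 * real n ^ 5 + 4 * (ln x / real n) + 4 * ln K"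
      using elim Mx by (intro carleman_class_pv_bound[OF f K KM n1]) auto
    moreover have "A * (ln x / real n) \<le> A * (ln x / (y x / 2))"
      using elim A n_ge n1 by (intro mult_left_mono divide_left_mono) auto
    moreover have "y x = w powr (1 / \<alpha>) / c powr (1 / \<alpha>)"
      using w c by (simp add: y_def w_def powr_divide)
    ultimately have "cmod (pv_oscillatory \<psi> x) \<le> A * (ln x / (w powr (1 / \<alpha>) / c powr (1 / \<alpha>) / 2))"
      by (metis order.trans)
    also have "\<dots> = (A * 2 * c powr (1 / \<alpha>)) * norm (ln x / w powr (1 / \<alpha>))"
      using elim by simp
    finally show ?case by (simp add: w_def)
  qed
  show ?thesis by (rule bigoI[of _ "A * 2 * c powr (1 / \<alpha>)"]) (use ev in simp)
qed

section \<open>A flat function and its derivatives\<close>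

text \<open>
  The function \<open>flat_fun 0 0\<close> is \<open>exp (- 1 / x)\<close> for \<open>x > 0\<close>, extended by \<open>0\<close>; the index \<open>m\<close> records an
  additional factor \<open>x\<^sup>-\<^sup>m\<close> and the index \<open>i\<close> is the number of derivatives taken. Since
  \<open>(x\<^sup>-\<^sup>m exp (- 1 / x))' = (x\<^sup>-\<^sup>m\<^sup>-\<^sup>2 - m x\<^sup>-\<^sup>m\<^sup>-\<^sup>1) exp (- 1 / x)\<close>, all derivatives stay
  in this family, and the recursion doubles as the derivative formula.
\<close>

primrec flat_fun :: "nat \<Rightarrow> nat \<Rightarrow> real \<Rightarrow> real" where
  "flat_fun 0 m = (\<lambda>x. if x \<le> 0 then 0 else (1 / x) ^ m * exp (- (1 / x)))"
| "flat_fun (Suc i) m = (\<lambda>x. flat_fun i (m + 2) x - real m * flat_fun i (m + 1) x)"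

lemma power_mult_exp_minus_le_fact:
  fixes y :: real
  assumes "0 \<le> y"
  shows "y ^ n * exp (- y) \<le> fact n"
proof -
  have "(\<Sum>i\<in>{n}. y ^ i /\<^sub>R fact i) \<le> (\<Sum>i. y ^ i /\<^sub>R fact i)"
    using assms summable_exp_generic[of y] by (intro sum_le_suminf) auto
  then have "y ^ n / fact n \<le> exp y"
    by (simp add: exp_def divide_inverse mult.commute)
  then show ?thesis by (simp add: exp_minus field_simps)
qed

lemma flat_fun_nonpos [simp]: "x \<le> 0 \<Longrightarrow> flat_fun i m x = 0"
  by (induction i arbitrary: m) auto

text \<open>
  The two terms of the recursion contribute equally, because
  \<open>m (m + 1 + 2 i)! \<le> (m + 2 + 2 i)!\<close>; the base case is \<open>y\<^sup>m exp (- y) \<le> m!\<close>.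
\<close>

lemma flat_fun_bound: "\<bar>flat_fun i m x\<bar> \<le> 2 ^ i * fact (m + 2 * i)"
proof (induction i arbitrary: m)
  case 0
  show ?case
  proof (cases "x \<le> 0")
    case False
    then show ?thesis using power_mult_exp_minus_le_fact[of "1 / x" m] by (simp add: abs_mult)
  qed simp
next
  case (Suc i)
  have "\<bar>flat_fun (Suc i) m x\<bar> \<le> \<bar>flat_fun i (m + 2) x\<bar> + real m * \<bar>flat_fun i (m + 1) x\<bar>"
    by (simp add: abs_mult order.trans[OF abs_triangle_ineq4])
  also have "\<dots> \<le> 2 ^ i * fact (m + 2 + 2 * i) + real m * (2 ^ i * fact (m + 1 + 2 * i))"
    by (intro add_mono Suc mult_left_mono) auto
  also have "real m * (2 ^ i * fact (m + 1 + 2 * i)) \<le> 2 ^ i * fact (m + 2 + 2 * i)"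
  proof -
    have "fact (m + 2 + 2 * i) = real (m + 2 + 2 * i) * fact (m + 1 + 2 * i)"
      using fact_Suc[of "m + 1 + 2 * i", where 'a = real] by simp
    moreover have "real m * fact (m + 1 + 2 * i) \<le> real (m + 2 + 2 * i) * fact (m + 1 + 2 * i)"
      by (intro mult_right_mono) auto
    ultimately have "2 ^ i * (real m * fact (m + 1 + 2 * i)) \<le> 2 ^ i * fact (m + 2 + 2 * i)"
      by (intro mult_left_mono) auto
    then show ?thesis by (simp add: mult_ac)
  qed
  finally show ?case by (simp add: mult_ac)
qed

text \<open>
  Only the case \<open>i = 0\<close> involves analysis, the others follow by linearity. At the origin the
  difference quotient is \<open>O(\<bar>h\<bar>)\<close> because \<open>y\<^bsup>m + 2\<^esup> exp (- y)\<close> is bounded for \<open>y = 1 / h\<close>.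
\<close>

lemma flat_fun_has_derivative: "(flat_fun i m has_real_derivative flat_fun (Suc i) m x) (at x)"
proof (induction i arbitrary: m)
  case 0
  consider "x < 0" | "x = 0" | "0 < x" by linarith
  then show ?case
  proof cases
    case 1
    have "((\<lambda>_. 0) has_real_derivative 0) (at x)" by simp
    then have "(flat_fun 0 m has_real_derivative 0) (at x)"
      by (rule has_field_derivative_transform_within_open[of _ _ _ "{..<0}"]) (use 1 in auto)
    then show ?thesis using 1 by simp
  next
    case 2
    have le: "\<bar>flat_fun 0 m h / h\<bar> \<le> fact (m + 2) * \<bar>h\<bar>" for h :: real
    proof (cases "h \<le> 0")
      case False
      have "(1 / h) ^ (m + 2) * exp (- (1 / h)) \<le> fact (m + 2)"
        using False by (intro power_mult_exp_minus_le_fact) auto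
      then have "h * ((1 / h) ^ (m + 2) * exp (- (1 / h))) \<le> h * fact (m + 2)"
        using False by (intro mult_left_mono) auto
      moreover have "h * ((1 / h) ^ (m + 2) * exp (- (1 / h))) = flat_fun 0 m h / h"
        using False by (simp add: power_add power2_eq_square)
      ultimately show ?thesis using False by (simp add: mult.commute abs_mult)
    next
      case True
      then have "\<bar>flat_fun 0 m h / h\<bar> = 0" by (simp only: flat_fun_nonpos div_0 abs_zero)
      also have "0 \<le> fact (m + 2) * \<bar>h\<bar>" by (intro mult_nonneg_nonneg fact_ge_zero abs_ge_zero)
      finally show ?thesis .
    qed
    have "((\<lambda>h. fact (m + 2) * \<bar>h\<bar>) \<longlongrightarrow> fact (m + 2) * \<bar>0::real\<bar>) (at (0::real))"
      by (intro tendsto_intros)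
    then have "((\<lambda>h::real. fact (m + 2) * \<bar>h\<bar>) \<longlongrightarrow> 0) (at 0)"
      by (simp only: abs_zero mult_zero_right)
    then have "((\<lambda>h. flat_fun 0 m h / h) \<longlongrightarrow> 0) (at 0)"
      by (rule Lim_null_comparison[rotated]) (use le in \<open>simp only: real_norm_def eventually_True\<close>)
    moreover have "(flat_fun 0 m (0 + h) - flat_fun 0 m 0) / h = flat_fun 0 m h / h" for h
      by (simp only: flat_fun_nonpos order_refl add_0 diff_zero)
    ultimately have "(flat_fun 0 m has_real_derivative 0) (at 0)"
      unfolding DERIV_def by (simp only:)
    then show ?thesis using 2 by simp
  next
    case 3
    have 1: "((\<lambda>y. y ^ m * exp (- y)) has_real_derivative
        (real m * y ^ (m - 1) * exp (- y) - y ^ m * exp (- y))) (at y)" for y :: real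
      by (auto intro!: derivative_eq_intros)
    have 2: "((\<lambda>x. 1 / x) has_real_derivative - ((1 / x)\<^sup>2)) (at x)"
      using 3 by (auto intro!: derivative_eq_intros simp: power2_eq_square)
    have "(real m * y ^ (m - 1) * exp (- y) - y ^ m * exp (- y)) * - (y\<^sup>2)
        = y ^ (m + 2) * exp (- y) - real m * (y ^ (m + 1) * exp (- y))" for y :: real
      by (cases m) (simp_all add: algebra_simps power2_eq_square)
    then have "((\<lambda>x. (1 / x) ^ m * exp (- (1 / x))) has_real_derivative flat_fun (Suc 0) m x) (at x)"
      using DERIV_chain2[OF 1 2] 3 by simp
    then show ?thesis
      by (rule has_field_derivative_transform_within_open[of _ _ _ "{0<..}"]) (use 3 in auto)
  qed
next
  case (Suc i)
  have "((\<lambda>x. flat_fun i (m + 2) x - real m * flat_fun i (m + 1) x) has_real_derivative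
      flat_fun (Suc i) (m + 2) x - real m * flat_fun (Suc i) (m + 1) x) (at x)"
    by (intro DERIV_diff DERIV_cmult Suc)
  then show ?case by simp
qed

lemma flat_fun_mono: "x \<le> y \<Longrightarrow> flat_fun 0 0 x \<le> flat_fun 0 0 y"
  by (auto simp: frac_le)

section \<open>Lacunary sums of flat functions\<close>

text \<open>
  This is the \<open>n\<close>-th derivative of \<open>\<Sum>\<^sub>j b\<^sub>j g(2\<^sup>j t - 1/2)\<close> with \<open>g = flat_fun 0 0\<close>. The shift by \<open>1/2\<close>
  makes the \<open>j\<close>-th term vanish for \<open>t \<le> 2\<^bsup>-(j+1)\<^esup>\<close>, so that on \<open>[2\<^bsup>-(j+1)\<^esup>, 2\<^sup>-\<^sup>j]\<close>
  the \<open>j\<close>-th term comes first and, for rapidly decreasing \<open>b\<close>, governs the sum.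
\<close>

definition lacunary_flat :: "(nat \<Rightarrow> real) \<Rightarrow> nat \<Rightarrow> real \<Rightarrow> real" where
  "lacunary_flat b n t = (\<Sum>j. b j * 2 ^ (j * n) * flat_fun n 0 (2 ^ j * t - 1 / 2))"

context
  fixes b :: "nat \<Rightarrow> real"
  assumes b_nonneg: "\<And>j. 0 \<le> b j"
    and summable_b: "\<And>n. summable (\<lambda>j. b j * 2 ^ (j * n))"
begin

lemma lacunary_flat_term_bound:
  "\<bar>b j * 2 ^ (j * n) * flat_fun n 0 y\<bar> \<le> b j * 2 ^ (j * n) * (2 ^ n * fact (2 * n))"
  using flat_fun_bound[of n 0 y] b_nonneg by (simp add: abs_mult mult_left_mono)

lemma summable_lacunary_flat_bound: "summable (\<lambda>j. b j * 2 ^ (j * n) * (2 ^ n * fact (2 * n)))"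
  by (intro summable_mult2 summable_b)

lemma summable_lacunary_flat: "summable (\<lambda>j. b j * 2 ^ (j * n) * flat_fun n 0 (2 ^ j * t - 1 / 2))"
  using lacunary_flat_term_bound by (intro summable_comparison_test'[OF summable_lacunary_flat_bound]) auto

lemma lacunary_flat_bound: "\<bar>lacunary_flat b n t\<bar> \<le> 2 ^ n * fact (2 * n) * (\<Sum>j. b j * 2 ^ (j * n))"
proof -
  have "\<bar>lacunary_flat b n t\<bar> \<le> (\<Sum>j. b j * 2 ^ (j * n) * (2 ^ n * fact (2 * n)))"
    unfolding lacunary_flat_def real_norm_def[symmetric]
    by (rule norm_suminf_le[OF _ summable_lacunary_flat_bound])
       (unfold real_norm_def, rule lacunary_flat_term_bound)
  also have "\<dots> = (\<Sum>j. b j * 2 ^ (j * n)) * (2 ^ n * fact (2 * n))"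
    by (intro suminf_mult2[symmetric] summable_b)
  finally show ?thesis by (simp add: mult.commute)
qed

lemma lacunary_flat_nonpos: "t \<le> 0 \<Longrightarrow> lacunary_flat b n t = 0"
proof -
  assume "t \<le> 0"
  then have "2 ^ j * t - 1 / 2 \<le> 0" for j :: nat
    by (smt (verit, best) divide_pos_pos mult_nonneg_nonpos zero_le_power)
  then show ?thesis by (simp add: lacunary_flat_def)
qed

lemma lacunary_flat_has_derivative:
  "(lacunary_flat b n has_real_derivative lacunary_flat b (Suc n) t) (at t)"
proof -
  have "((\<lambda>t. \<Sum>j. b j * 2 ^ (j * n) * flat_fun n 0 (2 ^ j * t - 1 / 2)) has_real_derivative
      (\<Sum>j. b j * 2 ^ (j * Suc n) * flat_fun (Suc n) 0 (2 ^ j * t - 1 / 2))) (at t)"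
  proof (rule has_field_derivative_series'(2)[of UNIV])
    fix j t
    have "((\<lambda>t. flat_fun n 0 (2 ^ j * t - 1 / 2)) has_real_derivative
        flat_fun (Suc n) 0 (2 ^ j * t - 1 / 2) * 2 ^ j) (at t)"
      by (rule DERIV_chain2[OF flat_fun_has_derivative]) (auto intro!: derivative_eq_intros)
    from DERIV_cmult[OF this, of "b j * 2 ^ (j * n)"]
    show "((\<lambda>t. b j * 2 ^ (j * n) * flat_fun n 0 (2 ^ j * t - 1 / 2)) has_real_derivative
        b j * 2 ^ (j * Suc n) * flat_fun (Suc n) 0 (2 ^ j * t - 1 / 2)) (at t within UNIV)"
      by (simp add: power_add mult_ac del: flat_fun.simps)
  next
    show "uniformly_convergent_on UNIV (\<lambda>J t. \<Sum>j<J. b j * 2 ^ (j * Suc n) * flat_fun (Suc n) 0 (2 ^ j * t - 1 / 2))"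
    proof (rule Weierstrass_m_test')
      fix j and t :: real
      show "norm (b j * 2 ^ (j * Suc n) * flat_fun (Suc n) 0 (2 ^ j * t - 1 / 2))
          \<le> b j * 2 ^ (j * Suc n) * (2 ^ Suc n * fact (2 * Suc n))"
        using lacunary_flat_term_bound[of j "Suc n"] unfolding real_norm_def .
    qed (rule summable_lacunary_flat_bound)
  qed (use summable_lacunary_flat in auto)
  then show ?thesis by (simp add: lacunary_flat_def[abs_def] del: flat_fun.simps)
qed

lemma nth_derivative_on_lacunary_flat:
  "t \<in> {-1..1} \<Longrightarrow> nth_derivative_on {-1..1} n (lacunary_flat b 0) t = lacunary_flat b n t"
proof (induction n arbitrary: t)
  case (Suc n)
  have "(lacunary_flat b n has_vector_derivative lacunary_flat b (Suc n) t) (at t within {-1..1})"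
    using lacunary_flat_has_derivative
    by (simp add: has_real_derivative_iff_has_vector_derivative has_vector_derivative_at_within)
  then have "(nth_derivative_on {-1..1} n (lacunary_flat b 0) has_vector_derivative lacunary_flat b (Suc n) t) (at t within {-1..1})"
    by (rule has_vector_derivative_transform[rotated 2]) (use Suc in auto)
  then show ?case
    using Suc.prems by (simp add: vector_derivative_within_closed_interval)
qed simp

lemma smooth_on_lacunary_flat: "smooth_on {-1..1} (lacunary_flat b 0)"
  unfolding smooth_on_def differentiable_on_def
proof (intro allI ballI)
  fix n and t :: real assume t: "t \<in> {-1..1}"
  have "(lacunary_flat b n has_vector_derivative lacunary_flat b (Suc n) t) (at t within {-1..1})"
    using lacunary_flat_has_derivative
    by (simp only: has_real_derivative_iff_has_vector_derivative has_vector_derivative_at_within)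
  then have "lacunary_flat b n differentiable (at t within {-1..1})"
    by (rule differentiableI_vector)
  then show "nth_derivative_on {-1..1} n (lacunary_flat b 0) differentiable (at t within {-1..1})"
    by (rule differentiable_transform_within[OF _ zero_less_one t])
       (simp only: nth_derivative_on_lacunary_flat)
qed

end

section \<open>Lower bounds for one-sided phases\<close>

text \<open>
  Replacing \<open>dt / t\<close> by the smaller \<open>f' dt / (B u)\<close> makes the integrand an exact derivative, that of
  \<open>f - sin (x f) / x\<close>. This gives a lower bound without any monotonicity of \<open>f'\<close>: all that matters is
  that \<open>f\<close> moves by more than \<open>2 / x\<close>.
\<close>

lemma one_minus_cos_integral_lower_bound:
  fixes f f' :: "real \<Rightarrow> real"
  assumes a: "0 < a" "a \<le> u" and x: "0 < x" and B: "0 < B"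
    and f: "\<And>t. t \<in> {a..u} \<Longrightarrow> (f has_real_derivative f' t) (at t)"
    and f': "\<And>t. t \<in> {a..u} \<Longrightarrow> \<bar>f' t\<bar> \<le> B"
  shows "(f u - f a - 2 / x) / (B * u) \<le> integral {a..u} (\<lambda>t. (1 - cos (x * f t)) / t)"
proof -
  have "((\<lambda>t. (1 - cos (x * f t)) * f' t) has_integral
      (f u - sin (x * f u) / x) - (f a - sin (x * f a) / x)) {a..u}"
  proof (rule fundamental_theorem_of_calculus[OF a(2)])
    fix t assume t: "t \<in> {a..u}"
    show "((\<lambda>t. f t - sin (x * f t) / x) has_vector_derivative (1 - cos (x * f t)) * f' t) (at t within {a..u})"
      unfolding has_real_derivative_iff_has_vector_derivative[symmetric]
      using x by (auto intro!: derivative_eq_intros DERIV_subset[OF f[OF t]] simp: algebra_simps)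
  qed
  moreover have "((\<lambda>t. (1 - cos (x * f t)) / t * (B * u)) has_integral
      integral {a..u} (\<lambda>t. (1 - cos (x * f t)) / t) * (B * u)) {a..u}"
  proof (intro has_integral_mult_left integrable_integral integrable_continuous_interval continuous_intros)
    show "continuous_on {a..u} f"
      using f by (meson DERIV_isCont continuous_at_imp_continuous_on)
  qed (use a in auto)
  ultimately have "(f u - sin (x * f u) / x) - (f a - sin (x * f a) / x)
      \<le> integral {a..u} (\<lambda>t. (1 - cos (x * f t)) / t) * (B * u)"
  proof (rule has_integral_le)
    fix t assume t: "t \<in> {a..u}"
    have "(1 - cos (x * f t)) * f' t \<le> (1 - cos (x * f t)) * B"
      using f'[OF t] by (intro mult_left_mono) auto
    also have "\<dots> \<le> (1 - cos (x * f t)) * (B * (u / t))"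
      using t a B by (intro mult_left_mono) (auto simp: pos_le_divide_eq)
    finally show "(1 - cos (x * f t)) * f' t \<le> (1 - cos (x * f t)) / t * (B * u)" by simp
  qed
  moreover have "sin (x * f u) / x \<le> 1 / x" "- (1 / x) \<le> sin (x * f a) / x"
    using x divide_right_mono[of "sin (x * f u)" 1 x] divide_right_mono[of "-1" "sin (x * f a)" x] by auto
  ultimately have "f u - f a - 2 / x \<le> integral {a..u} (\<lambda>t. (1 - cos (x * f t)) / t) * (B * u)"
    by simp
  then show ?thesis using a B by (simp add: pos_divide_le_eq)
qed

text \<open>
  For a phase that vanishes on the negative axis the real part of the principal value is
  \<open>- \<integral> (1 - cos (x f t)) dt / t\<close>, whose integrand has a sign. Contributions of different
  ranges of \<open>t\<close> cannot cancel, so any part of the integral is a lower bound.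
\<close>

lemma norm_pv_oscillatory_one_sided_ge:
  fixes f :: "real \<Rightarrow> real"
  assumes cont: "continuous_on {-1..1} f" and d: "(f has_real_derivative d) (at 0)"
    and zero: "\<And>t. t \<le> 0 \<Longrightarrow> f t = 0" and a: "0 < a" "a \<le> 1"
  shows "integral {a..1} (\<lambda>t. (1 - cos (x * f t)) / t) \<le> norm (pv_oscillatory f x)"
proof -
  define G where "G = (\<lambda>t. (exp (\<i> * complex_of_real (x * f t)) - exp (\<i> * complex_of_real (x * f (- t)))) / complex_of_real t)"
  define g where "g = (\<lambda>t. (1 - cos (x * f t)) / t)"
  have contrefl: "continuous_on {-1..1} (\<lambda>t. f (- t))"
    by (rule continuous_on_compose2[OF cont]) (auto intro: continuous_intros)
  have lim: "((\<lambda>\<epsilon>. norm (integral {\<epsilon>..1} G)) \<longlongrightarrow> norm (pv_oscillatory f x)) (at_right 0)"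
    unfolding G_def by (intro tendsto_norm pv_oscillatory_tendsto[OF cont d])
  have "integral {a..1} g \<le> norm (integral {\<epsilon>..1} G)" if \<epsilon>: "\<epsilon> \<in> {0<..<a}" for \<epsilon>
  proof -
    have "G integrable_on {\<epsilon>..1}"
      unfolding G_def using \<epsilon>
      by (intro integrable_continuous_interval continuous_intros continuous_on_subset[OF cont] continuous_on_subset[OF contrefl]) auto
    then have "((\<lambda>t. - Re (G t)) has_integral - Re (integral {\<epsilon>..1} G)) {\<epsilon>..1}"
      by (intro has_integral_neg has_integral_Re integrable_integral)
    moreover have "- Re (G t) = g t" if "t \<in> {\<epsilon>..1}" for t
    proof -
      have "G t = (exp (\<i> * complex_of_real (x * f t)) - 1) / complex_of_real t"
        using that \<epsilon> zero[of "- t"] by (simp add: G_def)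
      then have "Re (G t) = (cos (x * f t) - 1) / t"
        by (simp add: Re_divide_of_real Re_exp)
      then show ?thesis by (simp only: g_def minus_divide_left minus_diff_eq)
    qed
    ultimately have g: "(g has_integral - Re (integral {\<epsilon>..1} G)) {\<epsilon>..1}"
      by (rule has_integral_eq[rotated])
    have "integral {a..1} g \<le> integral {\<epsilon>..1} g"
    proof (rule integral_subset_le)
      show "g integrable_on {\<epsilon>..1}" using g by blast
      then show "g integrable_on {a..1}" 
        by (rule integrable_subinterval_real) (use \<epsilon> in auto)
    qed (use \<epsilon> in \<open>auto simp: g_def\<close>)
    also have "\<dots> = - Re (integral {\<epsilon>..1} G)" using g by (rule integral_unique)
    also have "\<dots> \<le> norm (integral {\<epsilon>..1} G)" using abs_Re_le_cmod[of "integral {\<epsilon>..1} G"] by linarith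
    finally show ?thesis .
  qed
  then show ?thesis unfolding g_def[symmetric]
    by (intro tendsto_lowerbound[OF lim] eventually_mono[OF eventually_at_right_real[OF a(1)]]) auto
qed

text \<open>
  Every term is nondecreasing in \<open>t\<close>, so the increment is at least that of the \<open>j\<close>-th term, which
  grows from \<open>0\<close> to \<open>b\<^sub>j exp (- 2)\<close>.
\<close>

lemma lacunary_flat_increment:
  assumes b: "\<And>j. 0 \<le> b j" and summ: "\<And>n. summable (\<lambda>j. b j * 2 ^ (j * n))"
  shows "b j * exp (- 2) \<le> lacunary_flat b 0 (1 / 2 ^ j) - lacunary_flat b 0 (1 / 2 ^ Suc j)"
proof -
  define d where "d = (\<lambda>i. b i * 2 ^ (i * 0) * flat_fun 0 0 (2 ^ i * (1 / 2 ^ j) - 1 / 2) -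
     b i * 2 ^ (i * 0) * flat_fun 0 0 (2 ^ i * (1 / 2 ^ Suc j) - 1 / 2))"
  note s = summable_lacunary_flat[OF b summ, where n = 0]
  have d0: "0 \<le> d i" for i
  proof -
    have "flat_fun 0 0 (2 ^ i * (1 / 2 ^ Suc j) - 1 / 2) \<le> flat_fun 0 0 (2 ^ i * (1 / 2 ^ j) - 1 / 2)"
      by (intro flat_fun_mono) (simp add: field_simps)
    then show ?thesis using b[of i] unfolding d_def by (simp add: mult_left_mono del: flat_fun.simps)
  qed
  have "lacunary_flat b 0 (1 / 2 ^ j) - lacunary_flat b 0 (1 / 2 ^ Suc j) = suminf d"
    unfolding lacunary_flat_def d_def by (intro suminf_diff s)
  moreover have "sum d {j} \<le> suminf d"
  proof (rule sum_le_suminf)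
    show "summable d" unfolding d_def by (intro summable_diff s)
  qed (use d0 in auto)
  moreover have "d j = b j * exp (- 2)"
    by (simp add: d_def)
  ultimately show ?thesis by simp
qed

text \<open>
  The terms before the \<open>j\<close>-th have not started yet at \<open>t\<close>, and the later ones are dominated by a
  geometric series because \<open>b\<close> decays faster than the chain rule factors \<open>2\<^sup>i\<close> grow.
\<close>

lemma lacunary_flat_derivative_bound:
  assumes b: "\<And>j. 0 \<le> b j" and summ: "\<And>n. summable (\<lambda>j. b j * 2 ^ (j * n))"
    and decay: "\<And>j. b (Suc j) \<le> b j / 4" and t: "t \<le> 1 / 2 ^ j"
  shows "\<bar>lacunary_flat b 1 t\<bar> \<le> 8 * (b j * 2 ^ j)"
proof -
  define T where "T = (\<lambda>i. b i * 2 ^ (i * 1) * flat_fun 1 0 (2 ^ i * t - 1 / 2))"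
  have early: "T i = 0" if "i < j" for i
  proof -
    have "(2::real) ^ i * t \<le> 2 ^ i * (1 / 2 ^ j)" using t by (intro mult_left_mono) auto
    also have "\<dots> \<le> 2 ^ i * (1 / 2 ^ Suc i)"
      using that by (intro mult_left_mono divide_left_mono power_increasing) auto
    finally have "2 ^ i * t - 1 / 2 \<le> 0" by simp
    then show ?thesis unfolding T_def by (simp only: flat_fun_nonpos mult_zero_right)
  qed
  have geo: "b (i + j) * 2 ^ (i + j) \<le> b j * 2 ^ j * (1 / 2) ^ i" for i
  proof (induction i)
    case (Suc i)
    have "b (Suc i + j) * 2 ^ (Suc i + j) \<le> b (i + j) / 4 * 2 ^ (Suc i + j)"
      using decay[of "i + j"] by (intro mult_right_mono) auto
    also have "\<dots> = (b (i + j) * 2 ^ (i + j)) * (1 / 2)" by simp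
    also have "\<dots> \<le> (b j * 2 ^ j * (1 / 2) ^ i) * (1 / 2)" using Suc by (intro mult_right_mono) auto
    finally show ?case by simp
  qed simp
  have "lacunary_flat b 1 t = suminf T" unfolding lacunary_flat_def T_def ..
  also have "\<dots> = (\<Sum>i. T (i + j))"
  proof -
    have "summable T" unfolding T_def by (rule summable_lacunary_flat[OF b summ])
    moreover have "sum T {..<j} = 0" using early by (intro sum.neutral) simp
    ultimately show ?thesis using suminf_split_initial_segment[of T j] by simp
  qed
  also have "\<bar>\<dots>\<bar> \<le> (\<Sum>i. 4 * (b j * 2 ^ j) * (1 / 2) ^ i)"
    unfolding real_norm_def[symmetric]
  proof (rule norm_suminf_le)
    fix i
    have "\<bar>T (i + j)\<bar> \<le> b (i + j) * 2 ^ ((i + j) * 1) * (2 ^ 1 * fact (2 * 1))"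
      unfolding T_def by (rule lacunary_flat_term_bound[OF b summ])
    also have "\<dots> = 4 * (b (i + j) * 2 ^ (i + j))" by simp
    also have "\<dots> \<le> 4 * (b j * 2 ^ j * (1 / 2) ^ i)" using geo by (intro mult_left_mono) auto
    finally show "norm (T (i + j)) \<le> 4 * (b j * 2 ^ j) * (1 / 2) ^ i" by (simp add: mult_ac)
  qed (intro summable_mult, simp)
  also have "\<dots> = 4 * (b j * 2 ^ j) * 2"
    by (subst suminf_mult) (simp_all add: suminf_geometric)
  finally show ?thesis by simp
qed

text \<open>
  On this dyadic interval the phase \<open>x f\<close> increases by at least \<open>x b\<^sub>j exp (- 2) \<ge> 4\<close>, with a derivative of
  the same order as its average slope. So a fixed proportion of the interval, in the measure \<open>dt / t\<close>,
  sees an oscillating phase.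
\<close>

lemma lacunary_flat_dyadic_integral:
  assumes b: "\<And>j. 0 < b j" and summ: "\<And>n. summable (\<lambda>j. b j * 2 ^ (j * n))"
    and decay: "\<And>j. b (Suc j) \<le> b j / 4" and x: "4 * exp 2 \<le> x * b j" "0 < x"
  shows "exp (- 2) / 16 \<le> integral {1 / 2 ^ Suc j..1 / 2 ^ j} (\<lambda>t. (1 - cos (x * lacunary_flat b 0 t)) / t)"
proof -
  have b0: "0 \<le> b i" for i using b[of i] by simp
  define f where "f = lacunary_flat b 0"
  have "(f (1 / 2 ^ j) - f (1 / 2 ^ Suc j) - 2 / x) / (8 * (b j * 2 ^ j) * (1 / 2 ^ j))
      \<le> integral {1 / 2 ^ Suc j..1 / 2 ^ j} (\<lambda>t. (1 - cos (x * f t)) / t)"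
  proof (rule one_minus_cos_integral_lower_bound)
    show "(f has_real_derivative lacunary_flat b 1 t) (at t)" for t
      unfolding f_def using lacunary_flat_has_derivative[OF b0 summ, of 0] by simp
    show "\<bar>lacunary_flat b 1 t\<bar> \<le> 8 * (b j * 2 ^ j)" if "t \<in> {1 / 2 ^ Suc j..1 / 2 ^ j}" for t
      using that by (intro lacunary_flat_derivative_bound[OF b0 summ decay]) auto
  qed (use x b in \<open>auto simp: field_simps\<close>)
  moreover have "exp (- 2) / 16 \<le> (f (1 / 2 ^ j) - f (1 / 2 ^ Suc j) - 2 / x) / (8 * (b j * 2 ^ j) * (1 / 2 ^ j))"
  proof -
    have "2 / x \<le> b j * exp (- 2) / 2"
      using x b[of j] by (simp add: exp_minus field_simps)
    moreover have "b j * exp (- 2) \<le> f (1 / 2 ^ j) - f (1 / 2 ^ Suc j)"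
      unfolding f_def by (rule lacunary_flat_increment[OF b0 summ])
    ultimately have "b j * exp (- 2) / 2 \<le> f (1 / 2 ^ j) - f (1 / 2 ^ Suc j) - 2 / x" by linarith
    moreover have "exp (- 2) / 16 * (8 * b j) = b j * exp (- 2) / 2" by simp
    ultimately have "exp (- 2) / 16 \<le> (f (1 / 2 ^ j) - f (1 / 2 ^ Suc j) - 2 / x) / (8 * b j)"
      using b[of j] by (subst pos_le_divide_eq) (simp, linarith)
    moreover have "8 * (b j * 2 ^ j) * (1 / 2 ^ j) = 8 * b j" by simp
    ultimately show ?thesis by (simp only:)
  qed
  ultimately show ?thesis unfolding f_def by linarith
qed

text \<open>
  Each of the first \<open>J\<close> dyadic scales contributes a fixed amount with the same sign.
\<close>

lemma lacunary_flat_pv_lower_bound: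
  assumes b: "\<And>j. 0 < b j" and summ: "\<And>n. summable (\<lambda>j. b j * 2 ^ (j * n))"
    and decay: "\<And>j. b (Suc j) \<le> b j / 4" and x: "\<And>j. j < J \<Longrightarrow> 4 * exp 2 \<le> x * b j" "0 < x"
  shows "real J * (exp (- 2) / 16) \<le> norm (pv_oscillatory (lacunary_flat b 0) x)"
proof -
  have b0: "0 \<le> b i" for i using b[of i] by simp
  define f where "f = lacunary_flat b 0"
  have f': "(f has_real_derivative lacunary_flat b 1 t) (at t)" for t
    unfolding f_def using lacunary_flat_has_derivative[OF b0 summ, of 0] by simp
  then have cont: "continuous_on S f" for S by (meson DERIV_isCont continuous_at_imp_continuous_on)
  define g where "g = (\<lambda>t. (1 - cos (x * f t)) / t)"
  have "real J * (exp (- 2) / 16) \<le> integral {1 / 2 ^ J..1} g"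
    using x(1)
  proof (induction J)
    case (Suc J)
    have pos: "(0::real) < 1 / 2 ^ Suc J" "1 / 2 ^ Suc J \<le> (1::real) / 2 ^ J" "(1::real) / 2 ^ J \<le> 1"
      by (simp_all add: divide_le_eq_1 frac_le)
    have "g integrable_on {1 / 2 ^ Suc J..1}"
      unfolding g_def
    proof (intro integrable_continuous_interval continuous_intros cont ballI)
      fix t :: real assume "t \<in> {1 / 2 ^ Suc J..1}"
      then show "t \<noteq> 0" using less_le_trans[OF pos(1), of t] by (simp only: atLeastAtMost_iff) blast
    qed
    then have "integral {1 / 2 ^ Suc J..1} g = integral {1 / 2 ^ Suc J..1 / 2 ^ J} g + integral {1 / 2 ^ J..1} g"
      by (intro Henstock_Kurzweil_Integration.integral_combine[symmetric] pos)
    moreover have "exp (- 2) / 16 \<le> integral {1 / 2 ^ Suc J..1 / 2 ^ J} g"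
      unfolding g_def f_def using Suc.prems x(2) by (intro lacunary_flat_dyadic_integral[OF b summ decay]) auto
    moreover have "real J * (exp (- 2) / 16) \<le> integral {1 / 2 ^ J..1} g" using Suc by simp
    ultimately show ?case by (simp add: algebra_simps)
  qed simp
  also have "\<dots> \<le> norm (pv_oscillatory f x)"
    unfolding g_def
    by (rule norm_pv_oscillatory_one_sided_ge[OF cont f'])
       (simp_all add: f_def lacunary_flat_nonpos[OF b0 summ])
  finally show ?thesis unfolding f_def .
qed

section \<open>Weights with slowly growing order of vanishing\<close>

text \<open>
  The exponent is \<open>n + 2\<close> on the scales \<open>J (n - 1) \<le> j < J n\<close>. So the weight \<open>2\<^bsup>-j (n + 2)\<^esup>\<close> makes the sum
  behave like \<open>t\<^bsup>n + 2\<^esup>\<close> at \<open>t \<approx> 2\<^sup>-\<^sup>j\<close>, with an order of vanishing that grows slowly as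
  \<open>t \<rightarrow> 0\<close> at a speed prescribed by \<open>J\<close>. The summand \<open>2\<close> guarantees a decay of at least \<open>4\<^sup>-\<^sup>j\<close>.
\<close>

definition scale_exponent :: "(nat \<Rightarrow> nat) \<Rightarrow> nat \<Rightarrow> nat" where
  "scale_exponent J j = 2 + (LEAST n. j < J n)"

definition scale_weight :: "(nat \<Rightarrow> nat) \<Rightarrow> nat \<Rightarrow> real" where
  "scale_weight J j = (1 / 2) ^ (j * scale_exponent J j)"

context
  fixes J :: "nat \<Rightarrow> nat"
  assumes mono_J: "mono J" and unbounded_J: "\<And>j. \<exists>n. j < J n"
begin

lemma scale_exponent_le: "j < J n \<Longrightarrow> scale_exponent J j \<le> n + 2"
  unfolding scale_exponent_def by (simp add: Least_le)

lemma scale_exponent_ge: "J n \<le> j \<Longrightarrow> n + 1 \<le> scale_exponent J j"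
proof -
  assume "J n \<le> j"
  moreover have "j < J (LEAST n. j < J n)" using unbounded_J[of j] by (rule LeastI_ex)
  ultimately have "J n < J (LEAST n. j < J n)" by (rule le_less_trans)
  then have "n < (LEAST n. j < J n)" using mono_J monoD not_less by metis
  then show ?thesis by (simp add: scale_exponent_def)
qed

lemma scale_exponent_Suc: "scale_exponent J j \<le> scale_exponent J (Suc j)"
proof -
  have "Suc j < J (LEAST n. Suc j < J n)" using unbounded_J[of "Suc j"] by (rule LeastI_ex)
  then have "(LEAST n. j < J n) \<le> (LEAST n. Suc j < J n)" by (intro Least_le) simp
  then show ?thesis by (simp add: scale_exponent_def)
qed

lemma scale_weight_pos: "0 < scale_weight J j"
  by (simp add: scale_weight_def)

lemma scale_weight_decay: "scale_weight J (Suc j) \<le> scale_weight J j / 4"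
proof -
  have "2 \<le> scale_exponent J (Suc j)" by (simp add: scale_exponent_def)
  moreover have "j * scale_exponent J j \<le> j * scale_exponent J (Suc j)"
    using scale_exponent_Suc by (rule mult_le_mono2)
  ultimately have "j * scale_exponent J j + 2 \<le> Suc j * scale_exponent J (Suc j)"
    by (simp only: mult_Suc)
  then have "scale_weight J (Suc j) \<le> (1 / 2) ^ (j * scale_exponent J j + 2)"
    unfolding scale_weight_def by (intro power_decreasing) auto
  then show ?thesis by (simp add: scale_weight_def power_add power2_eq_square)
qed

text \<open>
  For \<open>j \<ge> J n\<close> the exponent in the weight exceeds the order \<open>n\<close> of differentiation and leaves a geometric series; only the
  first \<open>J n\<close> scales can make the \<open>n\<close>-th derivative large.
\<close>

lemma scale_weight_moment_le:
  "scale_weight J j * 2 ^ (j * n) \<le> (if j < J n then 2 ^ (J n * n) else 0) + (1 / 2) ^ j"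
proof (cases "j < J n")
  case True
  have "scale_weight J j * 2 ^ (j * n) \<le> 1 * 2 ^ (J n * n)"
    unfolding scale_weight_def using True
    by (intro mult_mono power_le_one power_increasing) auto
  also have "\<dots> \<le> 2 ^ (J n * n) + (1 / 2) ^ j" by simp
  finally show ?thesis using True by simp
next
  case False
  then have "n + 1 \<le> scale_exponent J j" by (intro scale_exponent_ge) simp
  then have "j * (n + 1) \<le> j * scale_exponent J j" by (rule mult_le_mono2)
  then have "scale_weight J j \<le> (1 / 2) ^ (j * n + j)"
    unfolding scale_weight_def by (intro power_decreasing) auto
  then have "scale_weight J j * 2 ^ (j * n) \<le> (1 / 2) ^ (j * n + j) * 2 ^ (j * n)"
    by (intro mult_right_mono) auto
  also have "\<dots> = (1 / 2) ^ j" by (simp add: power_add power_one_over)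
  finally show ?thesis using False by simp
qed

lemma summable_cutoff_geometric: "summable (\<lambda>j. (if j < (N::nat) then (c::real) else 0) + (1 / 2) ^ j)"
  by (intro summable_add summable_geometric) (auto intro!: summable_finite[of "{..<N}"])

lemma summable_scale_weight: "summable (\<lambda>j. scale_weight J j * 2 ^ (j * n))"
proof (rule summable_comparison_test'[OF summable_cutoff_geometric])
  fix j
  show "norm (scale_weight J j * 2 ^ (j * n)) \<le> (if j < J n then 2 ^ (J n * n) else 0) + (1 / 2) ^ j"
    using scale_weight_moment_le[of j n] scale_weight_pos[of j] by simp
qed

lemma suminf_scale_weight_le: "(\<Sum>j. scale_weight J j * 2 ^ (j * n)) \<le> real (J n) * 2 ^ (J n * n) + 2"
proof -
  have fin: "(\<lambda>j. if j < J n then (2::real) ^ (J n * n) else 0) sums (\<Sum>j<J n. if j < J n then 2 ^ (J n * n) else 0)"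
    by (rule sums_finite) auto
  have geo: "(\<lambda>j. (1 / 2 :: real) ^ j) sums 2" using geometric_sums[of "1 / 2 :: real"] by simp
  have "(\<Sum>j. scale_weight J j * 2 ^ (j * n)) \<le> (\<Sum>j. (if j < J n then 2 ^ (J n * n) else 0) + (1 / 2) ^ j)"
    by (intro suminf_le scale_weight_moment_le summable_scale_weight summable_cutoff_geometric)
  also have "\<dots> = (\<Sum>j<J n. if j < J n then 2 ^ (J n * n) else 0) + 2"
    using sums_add[OF fin geo] by (simp only: sums_unique[symmetric])
  also have "\<dots> = real (J n) * 2 ^ (J n * n) + 2" by simp
  finally show ?thesis .
qed

text \<open>
  On the first \<open>J n\<close> scales the weights are not small, so a frequency of about \<open>2\<^bsup>J n (n + 2)\<^esup>\<close> makes all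
  of them oscillate at once.
\<close>

lemma scale_weight_ge: "j < J n \<Longrightarrow> (1 / 2) ^ (J n * (n + 2)) \<le> scale_weight J j"
  unfolding scale_weight_def
  using scale_exponent_le[of j n] by (intro power_decreasing mult_le_mono) auto

end

lemma eventually_le_imp_le_power_Suc_mult:
  fixes A M :: "nat \<Rightarrow> real"
  assumes "\<forall>\<^sub>F n in sequentially. A n \<le> M n" and M: "\<And>n. 0 < M n"
  obtains K where "0 < K" "\<And>n. A n \<le> K ^ (n + 1) * M n"
proof -
  obtain n0 where n0: "\<And>n. n0 \<le> n \<Longrightarrow> A n \<le> M n" using assms(1) by (auto simp: eventually_sequentially)
  define K where "K = 1 + (\<Sum>n<n0. \<bar>A n\<bar> / M n)"
  have K1: "1 \<le> K" unfolding K_def using M by (simp add: sum_nonneg less_imp_le)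
  have "A n \<le> K ^ (n + 1) * M n" for n
  proof -
    have "A n \<le> K * M n"
    proof (cases "n < n0")
      case True
      have "\<bar>A n\<bar> / M n \<le> (\<Sum>n<n0. \<bar>A n\<bar> / M n)"
        using True M by (intro member_le_sum) (auto simp: less_imp_le)
      then have "\<bar>A n\<bar> / M n \<le> K" by (simp add: K_def)
      then show ?thesis using M[of n] by (simp add: pos_divide_le_eq abs_le_iff)
    next
      case False
      then have "A n \<le> 1 * M n" using n0[of n] by simp
      also have "\<dots> \<le> K * M n" using K1 M[of n] by (intro mult_right_mono) auto
      finally show ?thesis .
    qed
    also have "\<dots> \<le> K ^ (n + 1) * M n"
      using K1 M[of n] self_le_power[of K "n + 1"] by (intro mult_right_mono) auto
    finally show ?thesis .
  qed
  then show ?thesis using K1 by (intro that[of K]) auto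
qed

text \<open>
  This is how a square root survives in the comparison: \<open>sqrt (exp z) = exp (z / 2)\<close>, and halving below an
  iterated exponential costs no more than halving its argument.
\<close>

lemma iter_exp_half: "2 \<le> y \<Longrightarrow> iter_exp k (y / 2) \<le> iter_exp k y / 2"
proof (induction k)
  case 0
  show ?case by (simp only: funpow.simps id_apply order_refl)
next
  case (Suc k)
  define w where "w = iter_exp k y"
  have w: "2 \<le> w" using le_iter_exp[of y k] Suc.prems unfolding w_def by (rule order.trans[rotated])
  have "exp (iter_exp k (y / 2)) \<le> exp (w / 2)" using Suc by (simp only: exp_le_cancel_iff w_def)
  also have "\<dots> \<le> exp w / 2"
  proof -
    have "2 \<le> exp (w / 2)" using exp_ge_add_one_self[of "w / 2"] w by linarith
    then have "2 * exp (w / 2) \<le> exp (w / 2) * exp (w / 2)" by (intro mult_right_mono) auto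
    also have "\<dots> = exp w" by (simp flip: exp_add)
    finally show ?thesis by simp
  qed
  finally show ?case by (simp only: iter_exp_Suc w_def)
qed

text \<open>
  With \<open>s\<^sup>2 = ln M\<^sub>n\<close> this says that \<open>J n \<le> sqrt (ln M\<^sub>n)\<close> keeps the \<open>n\<close>-th derivative below
  \<open>M\<^sub>n\<close>: the exponents of all factors add up to at most \<open>s (n + 3) \<le> s\<^sup>2\<close>.
\<close>

lemma growth_dominates:
  fixes s E :: real and n J :: nat
  assumes n: "3 \<le> n" and s: "real n ^ 3 \<le> s" and J: "real J \<le> s"
  shows "2 ^ n * fact (2 * n) * (real J * 2 ^ (J * n) + 2) \<le> exp (s\<^sup>2)"
proof -
  have two: "(2::real) ^ i \<le> exp (real i)" for i
  proof -
    have "(2::real) ^ i \<le> exp 1 ^ i" using exp_ge_add_one_self[of 1] by (intro power_mono) auto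
    then show ?thesis by (simp flip: exp_of_nat_mult)
  qed
  have fact_le: "fact (2 * n) \<le> exp (4 * real n ^ 2)"
  proof -
    have "fact (2 * n) \<le> real (2 * n) ^ (2 * n)" using fact_le_power[of "2 * n", where 'a = real] by simp
    also have "\<dots> \<le> exp (real (2 * n)) ^ (2 * n)"
      using exp_ge_add_one_self[of "real (2 * n)"] by (intro power_mono) linarith+
    also have "\<dots> = exp (4 * real n ^ 2)" by (simp add: power2_eq_square flip: exp_of_nat_mult)
    finally show ?thesis .
  qed
  have "real J * 2 ^ (J * n) + 2 \<le> (real J + 2) * 2 ^ (J * n)" by (simp add: algebra_simps)
  also have "\<dots> \<le> exp (real J + 2) * exp (real (J * n))"
  proof (intro mult_mono two)
    show "real J + 2 \<le> exp (real J + 2)" using exp_ge_add_one_self[of "real J + 2"] by linarith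
  qed auto
  finally have "2 ^ n * fact (2 * n) * (real J * 2 ^ (J * n) + 2)
      \<le> exp (real n) * exp (4 * real n ^ 2) * (exp (real J + 2) * exp (real (J * n)))"
    by (intro mult_mono two fact_le) auto
  also have "\<dots> = exp (real n + 4 * real n ^ 2 + 2 + real J * (real n + 1))"
    by (simp add: algebra_simps flip: exp_add)
  also have "\<dots> \<le> exp (s\<^sup>2)"
  proof -
    have n3: "3 \<le> real n" using n by simp
    have sq: "9 \<le> real n ^ 2" using power_mono[OF n3, of 2] by simp
    have "3 * real n \<le> real n * real n" using n3 by (intro mult_right_mono) auto
    then have a: "3 * real n \<le> real n ^ 2" by (simp add: power2_eq_square)
    have "3 * real n ^ 2 \<le> real n * real n ^ 2" using n3 by (intro mult_right_mono) auto
    then have b: "3 * real n ^ 2 \<le> s" using s by (simp add: power2_eq_square power3_eq_cube)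
    have s0: "0 \<le> s" using b by (smt (verit) zero_le_power2)
    have "real J * (real n + 1) \<le> s * (real n + 1)" using J by (intro mult_right_mono) auto
    moreover have "real n + 4 * real n ^ 2 + 2 \<le> s * 2" using a b sq by linarith
    ultimately have "real n + 4 * real n ^ 2 + 2 + real J * (real n + 1) \<le> s * (real n + 3)"
      by (simp add: algebra_simps)
    also have "\<dots> \<le> s * s" using a b s0 n3 by (intro mult_left_mono) linarith+
    finally show ?thesis by (simp add: power2_eq_square)
  qed
  finally show ?thesis .
qed

section \<open>Sharpness\<close>

text \<open>
  With \<open>J n\<close> about \<open>sqrt (ln M\<^sub>n)\<close> and \<open>L\<^sub>n\<close> about \<open>2\<^bsup>J n (n + 2)\<^esup>\<close>, the principal value at \<open>L\<^sub>n\<close> is at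
  least a multiple of \<open>J n\<close>, while \<open>ln L\<^sub>n\<close> is about \<open>J n * n\<close>. So the principal value has size
  \<open>ln L\<^sub>n / n\<close>. Finally \<open>ln L\<^sub>n \<ge> sqrt (ln M\<^sub>n)\<close> gives \<open>iter_log k L\<^sub>n \<ge> c n\<^sup>\<alpha> / 2\<close>, so \<open>1 / n\<close> is at
  least a multiple of the claimed factor.
\<close>

lemma lacunary_flat_extremal:
  fixes c \<alpha> :: real and k :: nat
  assumes c: "c > 0" and \<alpha>: "\<alpha> > 0" and k: "k \<ge> 2"
  obtains \<psi> :: "real \<Rightarrow> real" and L :: "nat \<Rightarrow> real" and c' :: real
  where "\<psi> \<in> carleman_class {-1..1} (\<lambda>n. iter_exp k (c * real n powr \<alpha>))"
    and "filterlim L at_top sequentially" and "0 < c'"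
    and "\<forall>\<^sub>F n in sequentially.
           c' * (ln (L n) / (iter_log k (L n)) powr (1 / \<alpha>)) \<le> cmod (pv_oscillatory \<psi> (L n))"
proof -
  obtain k' where k': "k = Suc k'" "1 \<le> k'" using k by (cases k) auto
  obtain k'' where k'': "k' = Suc k''" using k' by (cases k') auto
  define y where "y = (\<lambda>n. c * real n powr \<alpha>)"
  define E where "E = (\<lambda>n. iter_exp k' (y n))"
  \<comment> \<open>The square root leaves room for the factor \<open>2\<^bsup>J n * n\<^esup>\<close> of the \<open>n\<close>-th derivative, and is
    invisible, up to a constant, after \<open>k\<close> logarithms.\<close>
  define J where "J = (\<lambda>n. nat \<lfloor>sqrt (E n)\<rfloor>)"
  have E_pos: "0 < E n" for n by (simp only: E_def k'' iter_exp_Suc exp_gt_zero)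
  have M: "iter_exp k (y n) = exp (E n)" for n by (simp only: E_def k' iter_exp_Suc)
  have J_le: "real (J n) \<le> sqrt (E n)" and J_gt: "sqrt (E n) < real (J n) + 1" for n
  proof -
    have "0 \<le> sqrt (E n)" using E_pos[of n] by simp
    then have "real (J n) = of_int \<lfloor>sqrt (E n)\<rfloor>" by (simp add: J_def)
    then show "real (J n) \<le> sqrt (E n)" "sqrt (E n) < real (J n) + 1" by linarith+
  qed
  have mono_J: "mono J"
  proof (rule monoI)
    fix m n :: nat assume "m \<le> n"
    then have "y m \<le> y n" unfolding y_def using c \<alpha> by (intro mult_left_mono powr_mono2) auto
    then have "sqrt (E m) \<le> sqrt (E n)" unfolding E_def by (intro real_sqrt_le_mono iter_exp_mono)
    then show "J m \<le> J n" unfolding J_def by (intro nat_mono floor_mono)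
  qed
  have ev_s: "\<forall>\<^sub>F n in sequentially. real n ^ 3 \<le> sqrt (E n)"
    using eventually_power_le_exp_powr[OF c \<alpha>, of 6]
  proof eventually_elim
    case (elim n)
    have "(real n ^ 3)\<^sup>2 = real n ^ 6" by (simp flip: power_mult)
    also have "\<dots> \<le> E n" using elim exp_le_iter_exp[OF k'(2), of "y n"] unfolding E_def y_def by (rule order.trans)
    finally show ?case by (rule real_le_rsqrt)
  qed
  have ev_J: "\<forall>\<^sub>F n in sequentially. n \<le> J n"
    using ev_s eventually_ge_at_top[of 1]
  proof eventually_elim
    case (elim n)
    have "real n \<le> real n ^ 3" using elim(2) by (intro self_le_power) auto
    then have "real n < real (J n) + 1" using elim(1) J_gt[of n] by linarith
    then show ?case by linarith
  qed
  have unbounded_J: "\<exists>n. j < J n" for j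
  proof -
    have "\<forall>\<^sub>F n in sequentially. j < J n"
      using ev_J eventually_gt_at_top[of j] by eventually_elim simp
    then show ?thesis by (rule eventually_happens'[rotated]) simp
  qed
  define b where "b = scale_weight J"
  define \<psi> where "\<psi> = lacunary_flat b 0"
  note b_pos = scale_weight_pos[OF mono_J unbounded_J, folded b_def]
  note summ = summable_scale_weight[OF mono_J unbounded_J, folded b_def]
  note decay = scale_weight_decay[OF mono_J unbounded_J, folded b_def]
  have b_nonneg: "0 \<le> b j" for j using b_pos[of j] by simp
  define A where "A = (\<lambda>n. 2 ^ n * fact (2 * n) * (\<Sum>j. b j * 2 ^ (j * n)))"
  have "\<forall>\<^sub>F n in sequentially. A n \<le> iter_exp k (y n)"
    using ev_s eventually_ge_at_top[of 3]
  proof eventually_elim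
    case (elim n)
    have "A n \<le> 2 ^ n * fact (2 * n) * (real (J n) * 2 ^ (J n * n) + 2)"
      unfolding A_def b_def
      by (intro mult_left_mono suminf_scale_weight_le[OF mono_J unbounded_J]) auto
    also have "\<dots> \<le> exp ((sqrt (E n))\<^sup>2)"
      using elim J_le by (intro growth_dominates)
    also have "\<dots> = iter_exp k (y n)" unfolding M using E_pos[of n] by simp
    finally show ?case .
  qed
  moreover have "0 < iter_exp k (y n)" for n by (simp only: M exp_gt_zero)
  ultimately obtain K where K: "0 < K" "\<And>n. A n \<le> K ^ (n + 1) * iter_exp k (y n)"
    by (rule eventually_le_imp_le_power_Suc_mult) blast
  have mem: "\<psi> \<in> carleman_class {-1..1} (\<lambda>n. iter_exp k (c * real n powr \<alpha>))"
    unfolding carleman_class_def \<psi>_def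
  proof (intro CollectI conjI exI[of _ K] allI ballI K(1))
    show "smooth_on {-1..1} (lacunary_flat b 0)" by (rule smooth_on_lacunary_flat[OF b_nonneg summ])
    fix n and t :: real assume t: "t \<in> {-1..1}"
    have "\<bar>nth_derivative_on {-1..1} n (lacunary_flat b 0) t\<bar> = \<bar>lacunary_flat b n t\<bar>"
      by (simp only: nth_derivative_on_lacunary_flat[OF b_nonneg summ t])
    also have "\<dots> \<le> A n" unfolding A_def by (rule lacunary_flat_bound[OF b_nonneg summ])
    also have "\<dots> \<le> K ^ (n + 1) * iter_exp k (c * real n powr \<alpha>)" using K(2) unfolding y_def .
    finally show "\<bar>nth_derivative_on {-1..1} n (lacunary_flat b 0) t\<bar> \<le> K ^ (n + 1) * iter_exp k (c * real n powr \<alpha>)" .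
  qed
  \<comment> \<open>The frequency for which \<open>L n * b j \<ge> 4 exp 2\<close> holds for all \<open>j < J n\<close>.\<close>
  define L where "L = (\<lambda>n. 4 * exp 2 * 2 ^ (J n * (n + 2)) :: real)"
  have L_pos: "0 < L n" for n by (simp add: L_def)
  have L_ge: "2 ^ (J n * (n + 2)) \<le> L n" for n
    unfolding L_def using exp_ge_add_one_self[of 2] by (simp add: mult_le_cancel_right1)
  have pv: "real (J n) * (exp (- 2) / 16) \<le> cmod (pv_oscillatory \<psi> (L n))" for n
    unfolding \<psi>_def
  proof (rule lacunary_flat_pv_lower_bound[OF b_pos summ decay _ L_pos])
    fix j assume "j < J n"
    then have "(1 / 2) ^ (J n * (n + 2)) \<le> b j"
      unfolding b_def by (rule scale_weight_ge[OF mono_J unbounded_J])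
    then have "L n * (1 / 2) ^ (J n * (n + 2)) \<le> L n * b j" using L_pos[of n] by (intro mult_left_mono) auto
    moreover have "L n * (1 / 2) ^ (J n * (n + 2)) = 4 * exp 2" by (simp add: L_def power_one_over)
    ultimately show "4 * exp 2 \<le> L n * b j" by simp
  qed
  have lim: "filterlim L at_top sequentially"
  proof (rule filterlim_at_top_mono[OF filterlim_real_sequentially])
    show "\<forall>\<^sub>F n in sequentially. real n \<le> L n"
      using ev_J
    proof eventually_elim
      case (elim n)
      have "n * 1 \<le> J n * (n + 2)" using elim by (intro mult_le_mono) auto
      then have "real n \<le> real (J n * (n + 2))" by (simp only: mult_1_right of_nat_le_iff)
      also have "\<dots> \<le> 2 ^ (J n * (n + 2))" by (rule less_imp_le) (rule of_nat_less_two_power)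
      also have "\<dots> \<le> L n" by (rule L_ge)
      finally show ?case .
    qed
  qed
  define q where "q = (c / 2) powr (1 / \<alpha>)"
  have q: "0 < q" using c by (simp add: q_def)
  define c' where "c' = q * (exp (- 2) / 16) / 4"
  have c': "0 < c'" using q by (simp add: c'_def)
  have "\<forall>\<^sub>F n in sequentially.
           c' * (ln (L n) / (iter_log k (L n)) powr (1 / \<alpha>)) \<le> cmod (pv_oscillatory \<psi> (L n))"
    using ev_J eventually_ge_at_top[of 9] eventually_power_le_exp_powr[OF c \<alpha>, of 1]
  proof eventually_elim
    case (elim n)
    have J1: "1 \<le> real (J n)" and n9: "9 \<le> real n" using elim by linarith+
    have Jn: "11 * real (J n) \<le> real (J n) * (real n + 2)"
      using n9 J1 mult_left_mono[of 11 "real n + 2" "real (J n)"] by simp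
    have y2: "2 \<le> y n"
    proof -
      have "exp 2 = exp 1 * exp (1::real)" by (simp flip: exp_add)
      also have "\<dots> \<le> 3 * 3" using exp_le by (intro mult_mono) auto
      also have "3 * 3 \<le> exp (y n)" using elim(3) n9 unfolding y_def power_one_right by linarith
      finally have "exp 2 \<le> exp (y n)" .
      then show ?thesis by simp
    qed
    have "iter_exp k (y n / 2) \<le> L n"
    proof -
      have "iter_exp k' (y n / 2) \<le> sqrt (E n)"
      proof -
        have "exp (iter_exp k'' (y n / 2)) \<le> exp (iter_exp k'' (y n) / 2)"
          using iter_exp_half[OF y2] by (simp only: exp_le_cancel_iff)
        moreover have "(exp (iter_exp k'' (y n) / 2))\<^sup>2 = E n"
          by (simp only: E_def k'' iter_exp_Suc power2_eq_square exp_add[symmetric] field_sum_of_halves)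
        then have "sqrt (E n) = exp (iter_exp k'' (y n) / 2)"
          by (rule real_sqrt_unique) (rule exp_ge_zero)
        ultimately show ?thesis by (simp only: k'' iter_exp_Suc)
      qed
      also have "sqrt (E n) \<le> real (J n * (n + 2)) * ln 2"
      proof -
        have "real (J n * (n + 2)) * (1 / 2) \<le> real (J n * (n + 2)) * ln 2"
          using ln2_ge_two_thirds by (intro mult_left_mono) auto
        moreover have "real (J n * (n + 2)) = real (J n) * (real n + 2)"
          by (simp only: of_nat_mult of_nat_add of_nat_numeral)
        ultimately show ?thesis using J_gt[of n] Jn J1 by linarith
      qed
      finally have "exp (iter_exp k' (y n / 2)) \<le> exp (real (J n * (n + 2)) * ln 2)"
        by (simp only: exp_le_cancel_iff)
      also have "\<dots> = 2 ^ (J n * (n + 2))"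
        by (simp only: exp_of_nat_mult exp_ln zero_less_numeral)
      finally show ?thesis using L_ge[of n] by (simp only: k' iter_exp_Suc)
    qed
    then have z: "y n / 2 \<le> iter_log k (L n)" by (rule iter_exp_le_imp_le_iter_log)
    have root: "q * real n \<le> iter_log k (L n) powr (1 / \<alpha>)"
    proof -
      have "q * real n = (c / 2) powr (1 / \<alpha>) * (real n powr \<alpha>) powr (1 / \<alpha>)"
        using n9 \<alpha> by (simp add: q_def powr_powr)
      also have "\<dots> = (c / 2 * real n powr \<alpha>) powr (1 / \<alpha>)"
        by (rule powr_mult[symmetric])
      also have "\<dots> = (y n / 2) powr (1 / \<alpha>)" by (simp only: y_def times_divide_eq_left)
      also have "\<dots> \<le> iter_log k (L n) powr (1 / \<alpha>)"
        using z y2 \<alpha> by (intro powr_mono2) auto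
      finally show ?thesis .
    qed
    have lnL: "ln (L n) \<le> 2 * (real (J n) * (real n + 2))"
    proof -
      have "ln (L n) = ln 4 + 2 + real (J n * (n + 2)) * ln 2"
        by (simp add: L_def ln_mult ln_realpow)
      moreover have "ln 4 \<le> (4::real) - 1" by (rule ln_le_minus_one) simp
      moreover have "real (J n * (n + 2)) * ln 2 \<le> real (J n * (n + 2)) * 1"
        using ln_le_minus_one[of "2::real"] by (intro mult_left_mono) auto
      moreover have "real (J n * (n + 2)) = real (J n) * (real n + 2)"
          by (simp only: of_nat_mult of_nat_add of_nat_numeral)
      ultimately show ?thesis using Jn J1 by linarith
    qed
    have "ln (L n) / (iter_log k (L n)) powr (1 / \<alpha>) \<le> 2 * (real (J n) * (real n + 2)) / (q * real n)"
      using lnL root q n9 J1 by (intro frac_le) auto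
    also have "\<dots> \<le> 4 * real (J n) / q"
    proof -
      have "2 * (real (J n) * (real n + 2)) \<le> 4 * real (J n) * real n"
        using n9 J1 mult_left_mono[of "real n + 2" "2 * real n" "2 * real (J n)"] by (simp add: mult_ac)
      then have "2 * (real (J n) * (real n + 2)) / (q * real n) \<le> 4 * real (J n) * real n / (q * real n)"
        using q n9 by (intro divide_right_mono) auto
      then show ?thesis using n9 by simp
    qed
    finally have "c' * (ln (L n) / (iter_log k (L n)) powr (1 / \<alpha>)) \<le> c' * (4 * real (J n) / q)"
      using c' by (intro mult_left_mono) auto
    also have "\<dots> = real (J n) * (exp (- 2) / 16)" using q by (simp add: c'_def)
    also have "\<dots> \<le> cmod (pv_oscillatory \<psi> (L n))" by (rule pv)
    finally show ?case .
  qed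
  then show thesis by (rule that[OF mem lim c'])
qed

theorem theorem8p1:
  fixes c \<alpha> :: real and k :: nat and I :: "real set" and M :: "nat \<Rightarrow> real"
  assumes "c > 0" and "\<alpha> > 0" and "k \<ge> 2"
  defines "I \<equiv> {-1..1}"
    and "M \<equiv> (\<lambda>n. iter_exp k (c * real n powr \<alpha>))"
  shows "(\<forall>\<psi>\<in>carleman_class I M.
            (\<lambda>x. cmod (pv_oscillatory \<psi> x))
              \<in> O[at_top](\<lambda>x. ln x / (iter_log k x) powr (1 / \<alpha>))) \<and>
         (\<exists>\<psi>\<in>carleman_class I M. \<exists>L :: nat \<Rightarrow> real.
            filterlim L at_top sequentially \<and>
            (\<exists>c'>0. \<exists>C'>0. \<forall>\<^sub>F n in sequentially.
               c' * (ln (L n) / (iter_log k (L n)) powr (1 / \<alpha>)) \<le> cmod (pv_oscillatory \<psi> (L n)) \<and>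
               cmod (pv_oscillatory \<psi> (L n)) \<le> C' * (ln (L n) / (iter_log k (L n)) powr (1 / \<alpha>))))"
proof -
  have upper: "(\<lambda>x. cmod (pv_oscillatory \<psi> x)) \<in> O[at_top](\<lambda>x. ln x / (iter_log k x) powr (1 / \<alpha>))"
    if "\<psi> \<in> carleman_class I M" for \<psi>
    using carleman_class_pv_bigo[OF assms(1-3)] that unfolding I_def M_def .
  obtain \<psi> L c' where \<psi>: "\<psi> \<in> carleman_class I M" and L: "filterlim L at_top sequentially" and c': "0 < c'"
    and lower: "\<forall>\<^sub>F n in sequentially.
           c' * (ln (L n) / (iter_log k (L n)) powr (1 / \<alpha>)) \<le> cmod (pv_oscillatory \<psi> (L n))"
    using lacunary_flat_extremal[OF assms(1-3)] unfolding I_def M_def .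
  obtain C' where C': "0 < C'" and ev: "\<forall>\<^sub>F x in at_top. norm (cmod (pv_oscillatory \<psi> x))
      \<le> C' * norm (ln x / (iter_log k x) powr (1 / \<alpha>))"
    using upper[OF \<psi>] unfolding bigo_def mem_Collect_eq by (elim exE conjE) (rule that)
  have "\<forall>\<^sub>F n in sequentially. norm (cmod (pv_oscillatory \<psi> (L n)))
      \<le> C' * norm (ln (L n) / (iter_log k (L n)) powr (1 / \<alpha>))"
    by (rule eventually_compose_filterlim[OF ev L])
  moreover have "\<forall>\<^sub>F n in sequentially. 1 \<le> L n"
    using L by (simp add: filterlim_at_top)
  ultimately have "\<forall>\<^sub>F n in sequentially. cmod (pv_oscillatory \<psi> (L n)) \<le> C' * (ln (L n) / (iter_log k (L n)) powr (1 / \<alpha>))"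
    by eventually_elim simp
  with lower have "\<forall>\<^sub>F n in sequentially.
      c' * (ln (L n) / (iter_log k (L n)) powr (1 / \<alpha>)) \<le> cmod (pv_oscillatory \<psi> (L n)) \<and>
      cmod (pv_oscillatory \<psi> (L n)) \<le> C' * (ln (L n) / (iter_log k (L n)) powr (1 / \<alpha>))"
    by (rule eventually_conj)
  then show ?thesis using upper \<psi> L c' C' by blast
qed

end
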